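(* Let $\beta>1$, $L>0$ and $\mu\in\mathbb{R}$. Consider observations $Y_i=T_\mu f(\theta_i,s_i)+\epsilon_i$, $i=1,\dots,n$, where $(\theta_i,s_i)$ are i.i.d. random points of $Z=\mathrm{S}^1\times[-1,1]$, independent of the errors $\epsilon_i$. Assume: (B1) the $\epsilon_i$ are i.i.d. with distribution $G$ satisfying, for some constants $I_0>0$, $v_0>0$, $$\int_{-\infty}^\infty \ln\frac{dG(u)}{dG(u+v)}\,dG(u)\le I_0v^2\quad\text{for all }|v|\le v_0;$$ (B2) there is a constant $C_3$, independent of $n$, such that for every $n$ and every non-negative measurable function $g$ on $Z$, $$E_{(\theta,s)}\Big[\sum_{i=1}^n g(\theta_i,s_i)\Big]\le C_3\,n\int_Z g(\theta,s)\,ds\,d\theta .$$ Then, with $\Psi_n=n^{-\beta/(2\beta+3)}$, there is a constant $c_1>0$ such that $$\liminf_{n\to\infty}\ \inf_{\hat f_n}\ \sup_{f\in H(\beta,L)}\Psi_n^{-2}\,\mathrm{MISE}(\hat f_n,f)\ge c_1,\qquad \mathrm{MISE}(\hat f_n,f)=E_f\Big[\int_{B_1}|\hat f_n(x)-f(x)|^2dx\Big],$$ where $B_1=\{x\in\mathbb{R}^2:\|x\|\le 1\}$ and the infimum is over all estimators $\hat f_n$, i.e. all (jointly) measurable functions of $x$ and the data $(\theta_i,s_i,Y_i)_{i=1}^n$.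
   Context: Function class: for $\beta>1$ and $L>0$, $H(\beta,L)$ is the class of functions $f:\mathbb{R}^2\to\mathbb{R}$ supported in the closed unit ball $B_1$ whose Fourier transform $\widetilde f(\xi)=\int_{\mathbb{R}^2}f(x)e^{-i\xi\cdot x}dx$ satisfies $\int_{\mathbb{R}^2}(1+\|\xi\|^2)^\beta|\widetilde f(\xi)|^2d\xi\le L$; since $\beta>1$, $f$ is taken to be its continuous representative. Exponential Radon transform: $\mu$ is a fixed real constant. For $\theta\in\mathrm{S}^1$ (the unit circle in $\mathbb{R}^2$), $\theta^\perp$ is the unit vector perpendicular to $\theta$ obtained by rotating $\theta$ by $\pi/2$ (a fixed orientation). For $(\theta,s)\in Z=\mathrm{S}^1\times[-1,1]$, $$T_\mu f(\theta,s)=\int_{x\cdot\theta=s}e^{\mu x\cdot\theta^\perp}f(x)\,dx,$$ with $dx$ arc length on the line $\{x: x\cdot\theta=s\}$. Errors: the $\epsilon_i$ have mean $0$ and finite variance $\sigma^2>0$. In (B1), $dG(u+v)$ denotes the distribution $G$ translated by $v$ (the law of $\epsilon-v$), and the integral is the Kullback distance $\int\ln\frac{dP}{dQ}dP$ ($+\infty$ if $P$ is not absolutely continuous with respect to $Q$) between $P=G$ and this translate $Q$. $E_{(\theta,s)}$ is expectation over the design points; $E_f$ is expectation with respect to the joint distribution of $(\theta_i,s_i,Y_i)$, $i=1,\dots,n$, when the true function is $f$. *)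

theory Defs
  imports "HOL-Probability.Probability"
begin

definition fourier_transform :: "(real^2 \<Rightarrow> real) \<Rightarrow> real^2 \<Rightarrow> complex" where
  "fourier_transform f \<xi> =
     (LINT x|lborel. of_real (f x) * exp (- \<i> * of_real (\<xi> \<bullet> x)))"

text \<open>The energy is a nonnegative Lebesgue integral, so it may be infinite; continuity of \<open>f\<close>
  picks the continuous representative (and makes \<open>f\<close> integrable).\<close>

definition sobolev_class :: "real \<Rightarrow> real \<Rightarrow> (real^2 \<Rightarrow> real) set" where
  "sobolev_class \<beta> L =
     {f. continuous_on UNIV f \<and> (\<forall>x. x \<notin> cball 0 1 \<longrightarrow> f x = 0) \<and>
         (\<integral>\<^sup>+ \<xi>. ennreal ((1 + (norm \<xi>)\<^sup>2) powr \<beta> * (cmod (fourier_transform f \<xi>))\<^sup>2) \<partial>lborel)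
           \<le> ennreal L}"

definition rot90 :: "real^2 \<Rightarrow> real^2" where
  "rot90 \<theta> = vector [- (\<theta> $ 2), \<theta> $ 1]"

text \<open>For a unit vector \<open>\<theta>\<close>, the map \<open>t \<mapsto> s \<theta> + t \<theta>\<^sup>\<bottom>\<close> is the arc-length
  parametrization of the line \<open>x \<bullet> \<theta> = s\<close>.\<close>

definition exp_radon :: "real \<Rightarrow> (real^2 \<Rightarrow> real) \<Rightarrow> (real^2) \<times> real \<Rightarrow> real" where
  "exp_radon \<mu> f = (\<lambda>(\<theta>, s).
     LINT t|lborel. (let x = s *\<^sub>R \<theta> + t *\<^sub>R rot90 \<theta> in exp (\<mu> * (x \<bullet> rot90 \<theta>)) * f x))"

text \<open>Arc length on the unit circle, of total mass \<open>2 * pi\<close>.\<close>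

definition circle_measure :: "(real^2) measure" where
  "circle_measure =
     distr (restrict_space lborel {0..<2*pi}) (restrict_space borel (sphere 0 1))
       (\<lambda>\<phi>. vector [cos \<phi>, sin \<phi>])"

definition Z_measure :: "((real^2) \<times> real) measure" where
  "Z_measure = circle_measure \<Otimes>\<^sub>M restrict_space lborel {-1..1}"

lemma space_Z_measure: "space Z_measure = sphere 0 1 \<times> {-1..1}"
  by (simp add: Z_measure_def circle_measure_def space_pair_measure space_restrict_space)

lemma circle_param_measurable [measurable]:
  "(\<lambda>\<phi>::real. vector [cos \<phi>, sin \<phi>] :: real^2)
     \<in> measurable (restrict_space lborel {0..<2*pi}) (restrict_space borel (sphere 0 1))"
proof -
  have eq: "(\<lambda>\<phi>::real. vector [cos \<phi>, sin \<phi>] :: real^2) =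
      (\<lambda>\<phi>. cos \<phi> *\<^sub>R axis 1 1 + sin \<phi> *\<^sub>R axis 2 1)"
    by (auto simp: vec_eq_iff forall_2 axis_def)
  have "continuous_on UNIV (\<lambda>\<phi>::real. vector [cos \<phi>, sin \<phi>] :: real^2)"
    unfolding eq by (intro continuous_intros)
  then have "(\<lambda>\<phi>::real. vector [cos \<phi>, sin \<phi>] :: real^2) \<in> measurable lborel borel"
    using borel_measurable_continuous_onI by simp
  moreover have "norm (vector [cos \<phi>, sin \<phi>] :: real^2) = 1" for \<phi> :: real
    by (simp add: norm_vec_def L2_set_def sum_2)
  ultimately show ?thesis
    by (intro measurable_restrict_space2 measurable_restrict_space1) auto
qed

lemma nn_integral_Z_measure:
  assumes [measurable]: "g \<in> borel_measurable Z_measure"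
  shows "(\<integral>\<^sup>+ z. g z \<partial>Z_measure) =
    (\<integral>\<^sup>+ \<phi> \<in> {0..<2*pi}. (\<integral>\<^sup>+ s \<in> {-1..1}. g (vector [cos \<phi>, sin \<phi>], s) \<partial>lborel) \<partial>lborel)"
proof -
  interpret S: sigma_finite_measure "restrict_space lborel {-1..1::real}"
    by (intro sigma_finite_measure_restrict_space) (auto intro: lborel.sigma_finite_measure_axioms)
  have [measurable]: "g \<in> borel_measurable (circle_measure \<Otimes>\<^sub>M restrict_space lborel {-1..1})"
    using assms by (simp add: Z_measure_def)
  have m: "(\<lambda>\<theta>. \<integral>\<^sup>+ s. g (\<theta>, s) \<partial>restrict_space lborel {-1..1})
      \<in> borel_measurable circle_measure"
    by measurable
  have "(\<integral>\<^sup>+ z. g z \<partial>Z_measure) =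
      (\<integral>\<^sup>+ \<theta>. \<integral>\<^sup>+ s. g (\<theta>, s) \<partial>restrict_space lborel {-1..1} \<partial>circle_measure)"
    unfolding Z_measure_def by (rule S.nn_integral_fst[symmetric]) measurable
  also have "\<dots> = (\<integral>\<^sup>+ \<phi>. \<integral>\<^sup>+ s. g (vector [cos \<phi>, sin \<phi>], s)
      \<partial>restrict_space lborel {-1..1} \<partial>restrict_space lborel {0..<2*pi})"
    using m unfolding circle_measure_def
    by (intro nn_integral_distr[OF circle_param_measurable])
  finally show ?thesis
    by (simp add: nn_integral_restrict_space)
qed

lemma exp_radon_measurable:
  assumes [measurable]: "f \<in> borel_measurable borel"
  shows "exp_radon \<mu> f \<in> borel_measurable Z_measure"
proof -
  have [measurable]: "rot90 \<in> borel_measurable borel"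
  proof (rule borel_measurable_continuous_onI)
    have eq: "rot90 = (\<lambda>\<theta>. (- (\<theta> $ 2)) *\<^sub>R axis 1 1 + (\<theta> $ 1) *\<^sub>R axis 2 1)"
      by (auto simp: fun_eq_iff rot90_def vec_eq_iff forall_2 axis_def)
    show "continuous_on UNIV rot90"
      unfolding eq by (intro continuous_intros)
  qed
  have *: "exp_radon \<mu> f \<in> borel_measurable (borel \<Otimes>\<^sub>M borel)"
    unfolding exp_radon_def Let_def by measurable
  have "sets Z_measure = sets (restrict_space borel (sphere 0 1) \<Otimes>\<^sub>M restrict_space borel {-1..1})"
    unfolding Z_measure_def circle_measure_def
    by (intro sets_pair_measure_cong) (simp_all cong: sets_restrict_space_cong)
  moreover have "(\<lambda>z. z) \<in> measurable (restrict_space borel (sphere (0::real^2) 1) \<Otimes>\<^sub>M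
      restrict_space borel {-1..1::real}) (borel \<Otimes>\<^sub>M borel)"
    by (rule measurable_pair)
      (auto simp: comp_def intro: measurable_compose[OF measurable_fst measurable_restrict_space1]
         measurable_compose[OF measurable_snd measurable_restrict_space1])
  ultimately have "(\<lambda>z. z) \<in> measurable Z_measure (borel \<Otimes>\<^sub>M borel)"
    using measurable_cong_sets by blast
  from measurable_compose[OF this *] show ?thesis .
qed

text \<open>In the library's \<open>KL_divergence b M N\<close> the reference measure is \<open>M\<close>, and it is the
  Bochner integral of \<open>log b (dN/dM)\<close> against \<open>N\<close>. For probability measures with
  \<open>P\<close> absolutely continuous with respect to \<open>Q\<close> the negative part of this
  integrand is always \<open>P\<close>-integrable, so non-integrability means that the integral is infinite.\<close>

definition kullback :: "'a measure \<Rightarrow> 'a measure \<Rightarrow> ereal" where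
  "kullback P Q =
     (if absolutely_continuous Q P \<and> integrable P (entropy_density (exp 1) Q P)
      then ereal (KL_divergence (exp 1) Q P) else \<infinity>)"

definition iid_vars :: "'w measure \<Rightarrow> 'b measure \<Rightarrow> 'i set \<Rightarrow> ('i \<Rightarrow> 'w \<Rightarrow> 'b) \<Rightarrow> bool" where
  "iid_vars M N I X \<longleftrightarrow>
     prob_space.indep_vars M (\<lambda>_. N) X I \<and>
     (\<forall>i\<in>I. \<forall>j\<in>I. distr M N (X i) = distr M N (X j))"

text \<open>The library's \<open>indep_var\<close> requires both variables to have the same type; this is the
  same notion without that restriction.\<close>

definition indep_rv ::
  "'w measure \<Rightarrow> 'a measure \<Rightarrow> ('w \<Rightarrow> 'a) \<Rightarrow> 'b measure \<Rightarrow> ('w \<Rightarrow> 'b) \<Rightarrow> bool" where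
  "indep_rv M S X T Y \<longleftrightarrow>
     X \<in> measurable M S \<and> Y \<in> measurable M T \<and>
     prob_space.indep_set M {X -` A \<inter> space M | A. A \<in> sets S}
                            {Y -` B \<inter> space M | B. B \<in> sets T}"

abbreviation data_space :: "nat \<Rightarrow> (nat \<Rightarrow> ((real^2) \<times> real) \<times> real) measure" where
  "data_space n \<equiv> PiM {..<n} (\<lambda>_. Z_measure \<Otimes>\<^sub>M borel)"

text \<open>The joint law of \<open>((\<theta>\<^sub>i, s\<^sub>i), Y\<^sub>i)\<close>, \<open>i < n\<close>, under the regression function
  \<open>exp_radon \<mu> f\<close>, with design points \<open>X\<close> and errors \<open>\<epsilon>\<close>.\<close>

definition data_law ::
  "real \<Rightarrow> 'w measure \<Rightarrow> nat \<Rightarrow> (nat \<Rightarrow> 'w \<Rightarrow> (real^2) \<times> real) \<Rightarrow> (nat \<Rightarrow> 'w \<Rightarrow> real) \<Rightarrow>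
   (real^2 \<Rightarrow> real) \<Rightarrow> (nat \<Rightarrow> ((real^2) \<times> real) \<times> real) measure" where
  "data_law \<mu> M n X \<epsilon> f =
     distr M (data_space n) (\<lambda>\<omega>. \<lambda>i\<in>{..<n}. (X i \<omega>, exp_radon \<mu> f (X i \<omega>) + \<epsilon> i \<omega>))"

type_synonym estimator = "real^2 \<Rightarrow> (nat \<Rightarrow> ((real^2) \<times> real) \<times> real) \<Rightarrow> real"

definition estimators :: "nat \<Rightarrow> estimator set" where
  "estimators n = {fh. (\<lambda>(x, d). fh x d) \<in> borel_measurable (borel \<Otimes>\<^sub>M data_space n)}"

definition MISE ::
  "(nat \<Rightarrow> ((real^2) \<times> real) \<times> real) measure \<Rightarrow> estimator \<Rightarrow> (real^2 \<Rightarrow> real) \<Rightarrow> ennreal" where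
  "MISE D fh f = (\<integral>\<^sup>+ d. (\<integral>\<^sup>+ x \<in> cball 0 1. ennreal (\<bar>fh x d - f x\<bar>\<^sup>2) \<partial>lborel) \<partial>D)"

definition rate :: "real \<Rightarrow> nat \<Rightarrow> real" where
  "rate \<beta> n = real n powr (- \<beta> / (2 * \<beta> + 3))"

end

(* Assouad's hypercube argument. Put a K x K grid of disjoint bumps of width h ~ n^(-1/(2 beta + 3))
   and height c h^beta into the square [0, 1/2]^2 and let f_S be the sum of the bumps in S.
   Every f_S lies in H(beta, L): up to a decaying factor its Fourier transform is a rescaled
   trigonometric polynomial, whose L^2 norm on each period is given by Parseval. Adding one bump changes
   f_S by h^(2 beta + 2) in squared L^2 norm, but changes the Radon data only on a strip of width h
   where it is of size h^(beta + 1), hence by h^(2 beta + 3) in squared L^2(Z) norm. By (B1) and (B2)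
   the Kullback distance of the two data laws is then O(n h^(2 beta + 3)) = O(1), so no estimator can
   tell whether the bump is present, and the K^2 ~ h^(-2) bumps contribute h^(2 beta) to the risk. *)

theory Submission
  imports Defs
begin

text \<open>The width is the largest h that keeps n h^(2 beta + 3) bounded. The obstacle is the
  Sobolev norm: it must be bounded at a possibly fractional order beta, uniformly in S, and at such
  an order disjoint supports do not make squared norms additive. On the Fourier side all bumps share
  one transform up to a phase, and the phases add up to a trigonometric polynomial with coefficients
  0 and 1. The profile (t (1 - t))^m with m >= beta + 1 is smooth enough that, after the weight (1 +
  s^2)^beta is spent, a factor 1 / (1 + s^2) is left over to sum the periods. (B1) shapes the
  testing part. It bounds only the Kullback distance, so the overlap of two laws is bounded below
  through the mean of l = ln (dP/dQ) and Jensen's inequality; and it speaks only of shifts |v| <=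
  v0, so the constant in the bump height is also chosen to keep all Radon differences within v0. The
  design is frozen first: given the design, changing the function just translates the errors, and
  Kullback distances add over the observations. (B2) enters when the resulting sum is averaged over
  the design. The weight exp (mu t) costs at most exp |mu|, since the bumps live in the unit
  disc.\<close>

section \<open>Two-point testing bounds from the Kullback distance\<close>

text \<open>Here \<open>l\<close> plays the role of \<open>ln (dP/dQ)\<close>; the last clause, an inequality only, says
  \<open>e\<^sup>-\<^sup>l P \<le> Q\<close> and so tolerates a part of \<open>Q\<close> singular to \<open>P\<close>.\<close>

definition lr_dominated :: "'a measure \<Rightarrow> 'a measure \<Rightarrow> real \<Rightarrow> ('a \<Rightarrow> real) \<Rightarrow> bool" where
  "lr_dominated P Q \<kappa> l \<longleftrightarrow> integrable P l \<and> (LINT x|P. l x) \<le> \<kappa> \<and>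
     (\<forall>B\<in>borel_measurable P. (\<integral>\<^sup>+x. B x * ennreal (exp (- l x)) \<partial>P) \<le> (\<integral>\<^sup>+x. B x \<partial>Q))"

text \<open>A finite bound on the Kullback distance excludes the infinite branch of
  \<open>kullback\<close>, so P has a density r with respect to Q and l = ln r. Then exp (- l) * r
  <= 1, which is the domination clause.\<close>

lemma kullback_imp_lr_dominated:
  assumes P: "prob_space P" and Q: "prob_space Q" and sets: "sets P = sets Q"
    and kl: "kullback P Q \<le> ereal \<kappa>"
  shows "\<exists>l. lr_dominated P Q \<kappa> l"
proof -
  interpret P: prob_space P by fact
  interpret Q: prob_space Q by fact
  let ?r = "RN_deriv Q P"
  let ?l = "entropy_density (exp 1) Q P"
  have ac: "absolutely_continuous Q P" and int: "integrable P ?l"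
    and le: "KL_divergence (exp 1) Q P \<le> \<kappa>"
    using kl by (auto simp: kullback_def split: if_splits)
  have dens: "density Q ?r = P"
    by (rule Q.density_RN_deriv[OF ac sets])
  have fin: "AE x in Q. ?r x \<noteq> \<infinity>"
    by (rule Q.RN_deriv_finite[OF _ ac sets]) unfold_locales
  have "(\<integral>\<^sup>+x. B x * ennreal (exp (- ?l x)) \<partial>P) \<le> (\<integral>\<^sup>+x. B x \<partial>Q)"
    if B: "B \<in> borel_measurable P" for B
  proof -
    have [measurable]: "B \<in> borel_measurable Q"
      using B sets measurable_cong_sets by blast
    have "(\<integral>\<^sup>+x. B x * ennreal (exp (- ?l x)) \<partial>P)
        = (\<integral>\<^sup>+x. B x * ennreal (exp (- ?l x)) \<partial>density Q ?r)"
      by (simp add: dens)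
    also have "\<dots> = (\<integral>\<^sup>+x. ?r x * (B x * ennreal (exp (- ?l x))) \<partial>Q)"
      by (rule nn_integral_density) (auto simp: entropy_density_def)
    also have "\<dots> \<le> (\<integral>\<^sup>+x. B x \<partial>Q)"
    proof (rule nn_integral_mono_AE, use fin in eventually_elim)
      fix x assume "?r x \<noteq> \<infinity>"
      then obtain t where t: "?r x = ennreal t" "t \<ge> 0"
        by (cases "?r x") auto
      \<comment> \<open>For t = 0 the product vanishes whatever value the logarithm has there; for t
        > 0 it is exactly 1.\<close>
      have "t * exp (- ?l x) \<le> 1"
        using t by (cases "t = 0") (auto simp: entropy_density_def log_def exp_minus)
      then have "?r x * ennreal (exp (- ?l x)) \<le> 1"
        using t by (simp add: ennreal_mult'[symmetric] ennreal_le_1)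
      then show "?r x * (B x * ennreal (exp (- ?l x))) \<le> B x"
        using mult_left_mono[of "?r x * ennreal (exp (- ?l x))" 1 "B x"] by (simp add: ac_simps)
    qed
    finally show ?thesis .
  qed
  moreover have "(LINT x|P. ?l x) \<le> \<kappa>"
    using le by (simp add: KL_divergence_def)
  ultimately show ?thesis
    using int unfolding lr_dominated_def by (intro exI[of _ ?l]) auto
qed

text \<open>Tensorization: log-likelihood ratios and Kullback bounds add up over independent
  coordinates. Domination is proved one coordinate at a time, which works because it is stated for
  all nonnegative test functions.\<close>

lemma lr_dominated_PiM:
  fixes P Q :: "'i \<Rightarrow> 'a measure"
  assumes "finite I" and P: "\<And>i. i \<in> I \<Longrightarrow> prob_space (P i)"
    and Q: "\<And>i. i \<in> I \<Longrightarrow> prob_space (Q i)"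
    and sets: "\<And>i. i \<in> I \<Longrightarrow> sets (P i) = sets (Q i)"
    and dom: "\<And>i. i \<in> I \<Longrightarrow> lr_dominated (P i) (Q i) (\<kappa> i) (l i)"
  shows "lr_dominated (PiM I P) (PiM I Q) (\<Sum>i\<in>I. \<kappa> i) (\<lambda>x. \<Sum>i\<in>I. l i (x i))"
proof -
  \<comment> \<open>\<open>product_prob_space\<close> asks for probability measures at all indices, also outside \<open>I\<close>.\<close>
  define P' where "P' i = (if i \<in> I then P i else return (count_space UNIV) undefined)" for i
  define Q' where "Q' i = (if i \<in> I then Q i else return (count_space UNIV) undefined)" for i
  have P': "prob_space (P' i)" for i
    using P by (auto simp: P'_def intro: prob_space_return)
  have Q': "prob_space (Q' i)" for i
    using Q by (auto simp: Q'_def intro: prob_space_return)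
  interpret P: product_prob_space P' UNIV
    by (intro product_prob_spaceI P')
  interpret Q: product_prob_space Q' UNIV
    by (intro product_prob_spaceI Q')
  have sets': "sets (P' i) = sets (Q' i)" for i
    using sets by (auto simp: P'_def Q'_def)
  have dom': "lr_dominated (P' i) (Q' i) (\<kappa> i) (l i)" if "i \<in> I" for i
    using dom that by (simp add: P'_def Q'_def)
  have lm: "l i \<in> borel_measurable (P' i)" if "i \<in> I" for i
    using dom'[OF that] by (auto simp: lr_dominated_def)
  have PI: "PiM J P = PiM J P'" "PiM J Q = PiM J Q'" if "J \<subseteq> I" for J
    using that by (auto simp: P'_def Q'_def intro!: PiM_cong)
  have int: "integrable (PiM I P') (\<lambda>x. l i (x i)) \<and> (LINT x|PiM I P'. l i (x i)) = (LINT x|P' i. l i x)"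
    if "i \<in> I" for i
  proof -
    have d: "distr (PiM I P') (P' i) (\<lambda>x. x i) = P' i"
      by (rule distr_PiM_component) (use that assms(1) P' in auto)
    have m: "(\<lambda>x. x i) \<in> measurable (PiM I P') (P' i)"
      using that by (rule measurable_component_singleton)
    have "integrable (P' i) (l i)"
      using dom'[OF that] by (auto simp: lr_dominated_def)
    then have "integrable (distr (PiM I P') (P' i) (\<lambda>x. x i)) (l i)" by (simp add: d)
    then have "integrable (PiM I P') (\<lambda>x. l i (x i))"
      by (rule integrable_distr[OF m])
    moreover have "(LINT x|P' i. l i x) = (LINT x|distr (PiM I P') (P' i) (\<lambda>x. x i). l i x)"
      by (simp add: d)
    then have "(LINT x|PiM I P'. l i (x i)) = (LINT x|P' i. l i x)"
      by (simp add: integral_distr[OF m lm[OF that]])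
    ultimately show ?thesis by simp
  qed
  have "\<forall>B\<in>borel_measurable (PiM J P').
     (\<integral>\<^sup>+x. B x * ennreal (exp (- (\<Sum>i\<in>J. l i (x i)))) \<partial>PiM J P') \<le> (\<integral>\<^sup>+x. B x \<partial>PiM J Q')"
    if "finite J" "J \<subseteq> I" for J
    using that
  proof (induction J rule: finite_induct)
    case empty
    then show ?case by (simp add: PiM_empty)
  next
    case (insert j J)
    show ?case
    proof
      fix B :: "('i \<Rightarrow> 'a) \<Rightarrow> ennreal" assume B[measurable]: "B \<in> borel_measurable (PiM (insert j J) P')"
      have jI: "j \<in> I" and JI: "J \<subseteq> I" using insert.prems by auto
      note lm[measurable (raw)]
      have lj[measurable]: "l j \<in> borel_measurable (P' j)" using lm jI by auto
      have sJ: "(\<lambda>x. \<Sum>i\<in>K. l i (x i)) \<in> borel_measurable (PiM K P')" if "K \<subseteq> I" for K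
      proof (rule borel_measurable_sum)
        fix i assume "i \<in> K"
        then have "(\<lambda>x. x i) \<in> measurable (PiM K P') (P' i)" "l i \<in> borel_measurable (P' i)"
          using that lm by auto
        then show "(\<lambda>x. l i (x i)) \<in> borel_measurable (PiM K P')"
          by (rule measurable_compose)
      qed
      note [measurable] = sJ[OF JI] sJ[OF insert.prems(1)]
      have B2: "B \<in> borel_measurable (PiM (insert j J) Q')"
        using B sets_PiM_cong[of "insert j J" "insert j J" P' Q'] sets' measurable_cong_sets by blast
      have up: "(\<lambda>(x, y). B (x(j := y))) \<in> borel_measurable (PiM J P' \<Otimes>\<^sub>M P' j)"
        by measurable
      have up1: "(\<lambda>y. B (x(j := y))) \<in> borel_measurable (P' j)" if "x \<in> space (PiM J P')" for x
        using measurable_compose[OF measurable_Pair1'[OF that] up] by simp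
      have Qj: "sigma_finite_measure (Q' j)" by unfold_locales
      have cB: "(\<lambda>x. \<integral>\<^sup>+y. B (x(j := y)) \<partial>Q' j) \<in> borel_measurable (PiM J P')"
      proof (rule sigma_finite_measure.borel_measurable_nn_integral[OF Qj])
        have "sets (PiM J P' \<Otimes>\<^sub>M Q' j) = sets (PiM J P' \<Otimes>\<^sub>M P' j)"
          by (intro sets_pair_measure_cong) (simp_all add: sets')
        then show "(\<lambda>(x, y). B (x(j := y))) \<in> borel_measurable (PiM J P' \<Otimes>\<^sub>M Q' j)"
          using up measurable_cong_sets by blast
      qed
      have "(\<integral>\<^sup>+x. B x * ennreal (exp (- (\<Sum>i\<in>insert j J. l i (x i)))) \<partial>PiM (insert j J) P')
          = (\<integral>\<^sup>+x. \<integral>\<^sup>+y. B (x(j := y)) *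
              ennreal (exp (- (\<Sum>i\<in>insert j J. l i ((x(j := y)) i)))) \<partial>P' j \<partial>PiM J P')"
        using insert.hyps by (intro P.product_nn_integral_insert) measurable
      also have "\<dots> = (\<integral>\<^sup>+x. (\<integral>\<^sup>+y. B (x(j := y)) * ennreal (exp (- l j y)) \<partial>P' j) *
              ennreal (exp (- (\<Sum>i\<in>J. l i (x i)))) \<partial>PiM J P')"
      proof (rule nn_integral_cong)
        fix x assume x: "x \<in> space (PiM J P')"
        have "(\<Sum>i\<in>J. l i ((x(j := y)) i)) = (\<Sum>i\<in>J. l i (x i))" for y
          using insert.hyps by (intro sum.cong) auto
        then have "ennreal (exp (- (\<Sum>i\<in>insert j J. l i ((x(j := y)) i))))
            = ennreal (exp (- l j y)) * ennreal (exp (- (\<Sum>i\<in>J. l i (x i))))" for y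
          using insert.hyps by (simp add: ennreal_mult'[symmetric] exp_add[symmetric])
        then show "(\<integral>\<^sup>+y. B (x(j := y)) * ennreal (exp (- (\<Sum>i\<in>insert j J. l i ((x(j := y)) i)))) \<partial>P' j)
           = (\<integral>\<^sup>+y. B (x(j := y)) * ennreal (exp (- l j y)) \<partial>P' j) * ennreal (exp (- (\<Sum>i\<in>J. l i (x i))))"
          using up1[OF x] by (simp add: mult.assoc[symmetric] nn_integral_multc)
      qed
      \<comment> \<open>For each fixed x the slice of B is a test function for coordinate j. The
        inner integral that results is a test function of the other coordinates, to which the
        induction hypothesis applies next.\<close>
      also have "\<dots> \<le> (\<integral>\<^sup>+x. (\<integral>\<^sup>+y. B (x(j := y)) \<partial>Q' j) *
              ennreal (exp (- (\<Sum>i\<in>J. l i (x i)))) \<partial>PiM J P')"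
        using dom'[OF jI] up1 unfolding lr_dominated_def
        by (intro nn_integral_mono mult_right_mono) auto
      also have "\<dots> \<le> (\<integral>\<^sup>+x. (\<integral>\<^sup>+y. B (x(j := y)) \<partial>Q' j) \<partial>PiM J Q')"
        using insert.IH[OF JI] cB by auto
      also have "\<dots> = (\<integral>\<^sup>+x. B x \<partial>PiM (insert j J) Q')"
        using insert.hyps B2 by (intro Q.product_nn_integral_insert[symmetric]) auto
      finally show "(\<integral>\<^sup>+x. B x * ennreal (exp (- (\<Sum>i\<in>insert j J. l i (x i)))) \<partial>PiM (insert j J) P')
         \<le> (\<integral>\<^sup>+x. B x \<partial>PiM (insert j J) Q')" .
    qed
  qed
  note dens = this[OF assms(1) order_refl]
  have "(LINT x|PiM I P'. (\<Sum>i\<in>I. l i (x i))) = (\<Sum>i\<in>I. LINT x|P' i. l i x)"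
    using int by (subst Bochner_Integration.integral_sum) auto
  also have "\<dots> \<le> (\<Sum>i\<in>I. \<kappa> i)"
    using dom' by (intro sum_mono) (auto simp: lr_dominated_def)
  finally show ?thesis
    unfolding PI[OF order_refl] lr_dominated_def using dens int by auto
qed

text \<open>The tangent at y = m of the convex function exp (- y). Integrated against a probability
  measure it serves as Jensen's inequality, with m any upper bound of the mean.\<close>

lemma exp_tangent: "exp (- m) * (1 + m - y) \<le> exp (- y :: real)"
proof -
  have "1 + (m - y) \<le> exp (m - y)" by (rule exp_ge_add_one_self)
  then have "exp (- m) * (1 + (m - y)) \<le> exp (- m) * exp (m - y)"
    by (intro mult_left_mono) auto
  then show ?thesis by (simp add: exp_add[symmetric] add_diff_eq)
qed

text \<open>A and B are to be the losses of one estimator under two hypotheses that it cannot both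
  fit. Moving B from Q to P costs a factor exp (- l), so the sum is at least delta times the mean of
  exp (- max 0 l), and Jensen's inequality applies. The + 1 pays for the positive part: max 0 l <= l
  + exp (- l), and exp (- l) has mean at most 1 under P because Q has mass 1.\<close>

lemma lr_dominated_two_point:
  fixes A B :: "'a \<Rightarrow> ennreal"
  assumes P: "prob_space P" and Q: "prob_space Q" and dom: "lr_dominated P Q \<kappa> l"
    and [measurable]: "A \<in> borel_measurable P" "B \<in> borel_measurable P"
    and AB: "\<And>x. x \<in> space P \<Longrightarrow> ennreal \<delta> \<le> A x + B x" and "\<delta> \<ge> 0"
  shows "ennreal (\<delta> * exp (- (\<kappa> + 1))) \<le> (\<integral>\<^sup>+x. A x \<partial>P) + (\<integral>\<^sup>+x. B x \<partial>Q)"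
proof -
  interpret P: prob_space P by fact
  interpret Q: prob_space Q by fact
  have int: "integrable P l" and le: "(LINT x|P. l x) \<le> \<kappa>"
    and ch: "\<And>B. B \<in> borel_measurable P \<Longrightarrow>
      (\<integral>\<^sup>+x. B x * ennreal (exp (- l x)) \<partial>P) \<le> (\<integral>\<^sup>+x. B x \<partial>Q)"
    using dom by (auto simp: lr_dominated_def)
  have [measurable]: "l \<in> borel_measurable P" using int by auto
  have e1: "(\<integral>\<^sup>+x. ennreal (exp (- l x)) \<partial>P) \<le> 1"
    using ch[of "\<lambda>_. 1"] Q.emeasure_space_1 by simp
  have ei: "integrable P (\<lambda>x. exp (- l x))"
    using e1 by (intro integrableI_nonneg) (auto simp: less_top[symmetric] top_unique)
  have el: "(LINT x|P. exp (- l x)) \<le> 1"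
    using e1 by (subst integral_eq_nn_integral) (auto intro: enn2real_leI)
  have mi: "integrable P (\<lambda>x. exp (- max 0 (l x)))"
    by (rule Bochner_Integration.integrable_bound[OF P.integrable_const[of "1::real"]]) auto
  \<comment> \<open>The point of tangency: an upper bound for the mean of l + exp (- l).\<close>
  let ?m = "\<kappa> + 1"
  have "exp (- ?m) * (1 + ?m - (l x + exp (- l x))) \<le> exp (- max 0 (l x))" for x
  proof -
    have "max 0 (l x) \<le> l x + exp (- l x)"
      using exp_ge_add_one_self[of "- l x"] by (auto simp: max_def)
    then have "exp (- ?m) * (1 + ?m - (l x + exp (- l x))) \<le> exp (- ?m) * (1 + ?m - max 0 (l x))"
      by (intro mult_left_mono) (linarith, simp)
    also have "\<dots> \<le> exp (- max 0 (l x))" by (rule exp_tangent)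
    finally show ?thesis .
  qed
  then have "(LINT x|P. exp (- ?m) * (1 + ?m - (l x + exp (- l x)))) \<le> (LINT x|P. exp (- max 0 (l x)))"
    using int ei mi by (intro integral_mono) auto
  moreover have "(LINT x|P. exp (- ?m) * (1 + ?m - (l x + exp (- l x))))
      = exp (- ?m) * (1 + ?m - ((LINT x|P. l x) + (LINT x|P. exp (- l x))))"
    using int ei by (simp add: P.prob_space)
  moreover have "exp (- ?m) * 1 \<le> exp (- ?m) * (1 + ?m - ((LINT x|P. l x) + (LINT x|P. exp (- l x))))"
    using le el by (intro mult_left_mono) auto
  ultimately have "exp (- ?m) \<le> (LINT x|P. exp (- max 0 (l x)))" by linarith
  then have "ennreal (\<delta> * exp (- ?m)) \<le> ennreal \<delta> * ennreal (LINT x|P. exp (- max 0 (l x)))"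
    using \<open>\<delta> \<ge> 0\<close> by (subst ennreal_mult'[symmetric]) (auto intro!: ennreal_leI mult_left_mono)
  also have "\<dots> = ennreal \<delta> * (\<integral>\<^sup>+x. ennreal (exp (- max 0 (l x))) \<partial>P)"
    using mi by (subst nn_integral_eq_integral) auto
  also have "\<dots> = (\<integral>\<^sup>+x. ennreal \<delta> * ennreal (exp (- max 0 (l x))) \<partial>P)"
    by (rule nn_integral_cmult[symmetric]) simp
  \<comment> \<open>\<open>exp (- max 0 (l x))\<close> is the minimum of 1 and
    \<open>exp (- l x)\<close>; the first bound serves A, the second B.\<close>
  also have "\<dots> \<le> (\<integral>\<^sup>+x. A x + B x * ennreal (exp (- l x)) \<partial>P)"
  proof (rule nn_integral_mono)
    fix x assume "x \<in> space P"
    then have "ennreal \<delta> * ennreal (exp (- max 0 (l x))) \<le> (A x + B x) * ennreal (exp (- max 0 (l x)))"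
      using AB by (intro mult_right_mono) auto
    also have "\<dots> \<le> A x * 1 + B x * ennreal (exp (- l x))"
      unfolding distrib_right by (intro add_mono mult_left_mono) (auto simp: ennreal_le_1 intro!: ennreal_leI)
    finally show "ennreal \<delta> * ennreal (exp (- max 0 (l x))) \<le> A x + B x * ennreal (exp (- l x))" by simp
  qed
  also have "\<dots> = (\<integral>\<^sup>+x. A x \<partial>P) + (\<integral>\<^sup>+x. B x * ennreal (exp (- l x)) \<partial>P)"
    by (rule nn_integral_add) auto
  also have "\<dots> \<le> (\<integral>\<^sup>+x. A x \<partial>P) + (\<integral>\<^sup>+x. B x \<partial>Q)"
    by (intro add_left_mono ch) auto
  finally show ?thesis .
qed

text \<open>Jensen's inequality again, in the form that averages a bound valid for each fixed design
  over the random design.\<close>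

lemma exp_neg_nn_integral_ge:
  fixes f :: "'a \<Rightarrow> real"
  assumes "prob_space P" and [measurable]: "f \<in> borel_measurable P" and nn: "\<And>x. f x \<ge> 0"
    and m: "(\<integral>\<^sup>+x. ennreal (f x) \<partial>P) \<le> ennreal m" "m \<ge> 0"
  shows "ennreal (exp (- m)) \<le> (\<integral>\<^sup>+x. ennreal (exp (- f x)) \<partial>P)"
proof -
  interpret prob_space P by fact
  have i: "integrable P f"
    using m nn by (intro integrableI_nonneg) (auto simp: less_top[symmetric] top_unique)
  have ie: "integrable P (\<lambda>x. exp (- f x))"
    by (rule Bochner_Integration.integrable_bound[OF integrable_const[of "1::real"]]) (auto simp: nn)
  have "(LINT x|P. f x) \<le> m"
    using m nn by (subst integral_eq_nn_integral) (auto intro: enn2real_leI)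
  then have "exp (- m) * 1 \<le> exp (- m) * (1 + m - (LINT x|P. f x))"
    by (intro mult_left_mono) auto
  also have "\<dots> = (LINT x|P. exp (- m) * (1 + m - f x))"
    using i by (simp add: prob_space)
  also have "\<dots> \<le> (LINT x|P. exp (- f x))"
    using i ie by (intro integral_mono exp_tangent) auto
  finally have "ennreal (exp (- m)) \<le> ennreal (LINT x|P. exp (- f x))" by (simp add: ennreal_leI)
  then show ?thesis using ie by (subst nn_integral_eq_integral) auto
qed

section \<open>Fourier decay of the bump profile\<close>

text \<open>The Fourier transform of a polynomial cut off to [0, 1]. Polynomials are closed under
  \<open>pderiv\<close>, so integration by parts can be iterated by induction.\<close>

definition poly_fourier :: "complex poly \<Rightarrow> real \<Rightarrow> complex" where
  "poly_fourier p s = integral {0..1} (\<lambda>t. poly p (of_real t) * exp (- \<i> * of_real (s * t)))"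

lemma poly_fourier_bounded: "\<exists>C. \<forall>s. cmod (poly_fourier p s) \<le> C"
proof -
  have "continuous_on {0..1::real} (\<lambda>t. poly p (of_real t))"
    by (intro continuous_intros)
  then have "compact ((\<lambda>t::real. poly p (of_real t)) ` {0..1})"
    by (rule compact_continuous_image) auto
  then have "bounded ((\<lambda>t::real. poly p (of_real t)) ` {0..1})"
    by (rule compact_imp_bounded)
  then obtain C where C: "\<And>t::real. t \<in> {0..1} \<Longrightarrow> cmod (poly p (of_real t)) \<le> C"
    unfolding bounded_iff ball_simps by blast
  have "cmod (poly_fourier p s) \<le> C * (1 - 0)" for s
    unfolding poly_fourier_def
    by (rule integral_bound) (auto intro!: continuous_intros simp: norm_mult C)
  then show ?thesis by auto
qed

text \<open>Integration by parts; the two hypotheses remove the boundary terms.\<close>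

lemma poly_fourier_pderiv:
  assumes "poly p 0 = 0" "poly p 1 = 0"
  shows "\<i> * of_real s * poly_fourier p s = poly_fourier (pderiv p) s"
proof -
  let ?e = "\<lambda>t::real. exp (- \<i> * of_real (s * t))"
  have d: "((\<lambda>t. poly p (of_real t) * ?e t) has_vector_derivative
      (poly (pderiv p) (of_real t) * ?e t - \<i> * of_real s * (poly p (of_real t) * ?e t))) (at t within {0..1})" for t
  proof -
    have "((\<lambda>z. poly p z * exp (- \<i> * of_real s * z)) has_field_derivative
       (poly (pderiv p) (of_real t) * exp (- \<i> * of_real s * of_real t)
         - \<i> * of_real s * (poly p (of_real t) * exp (- \<i> * of_real s * of_real t)))) (at (of_real t))"
      by (auto intro!: derivative_eq_intros poly_DERIV simp: algebra_simps)
    from has_vector_derivative_real_field[OF this, of "{0..1}"] show ?thesis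
      by (simp add: mult.assoc)
  qed
  have "((\<lambda>t. poly (pderiv p) (of_real t) * ?e t - \<i> * of_real s * (poly p (of_real t) * ?e t))
      has_integral (poly p (of_real 1) * ?e 1 - poly p (of_real 0) * ?e 0)) {0..1}"
    by (rule fundamental_theorem_of_calculus) (use d in auto)
  then have 1: "integral {0..1} (\<lambda>t. poly (pderiv p) (of_real t) * ?e t - \<i> * of_real s * (poly p (of_real t) * ?e t)) = 0"
    using assms by (simp add: integral_unique)
  have "integral {0..1} (\<lambda>t. poly (pderiv p) (of_real t) * ?e t - \<i> * of_real s * (poly p (of_real t) * ?e t))
    = poly_fourier (pderiv p) s - integral {0..1} (\<lambda>t. \<i> * of_real s * (poly p (of_real t) * ?e t))"
    unfolding poly_fourier_def
    by (rule integral_diff) (auto intro!: integrable_continuous_interval continuous_intros)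
  also have "\<dots> = poly_fourier (pderiv p) s - \<i> * of_real s * poly_fourier p s"
    unfolding poly_fourier_def by simp
  finally show ?thesis using 1 by simp
qed

text \<open>Differentiation lowers the order of a zero by at most one. Divisibility expresses the
  order of vanishing at 0 and at 1 simultaneously.\<close>

lemma dvd_pderiv_power:
  fixes q p :: "complex poly"
  assumes "q ^ Suc m dvd p"
  shows "q ^ m dvd pderiv p"
proof -
  obtain r where "p = q ^ Suc m * r" using assms by (elim dvdE)
  then have "pderiv p = q ^ m * (q * pderiv r + smult (of_nat (Suc m)) (pderiv q) * r)"
    by (simp only: pderiv_mult pderiv_power_Suc) (simp add: algebra_simps)
  then show ?thesis by simp
qed

text \<open>A factor (t (1 - t))^m keeps the boundary terms zero through m integrations by parts,
  each of which gains a factor 1 / |s|.\<close>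

lemma poly_fourier_decay:
  "([:0, 1:] * [:1, -1:]) ^ m dvd p \<Longrightarrow> \<exists>C. \<forall>s. \<bar>s\<bar> ^ m * cmod (poly_fourier p s) \<le> C"
proof (induction m arbitrary: p)
  case 0
  then show ?case using poly_fourier_bounded by simp
next
  case (Suc m)
  let ?q = "[:0, 1:] * [:1, -1:] :: complex poly"
  obtain C where C: "\<And>s. \<bar>s\<bar> ^ m * cmod (poly_fourier (pderiv p) s) \<le> C"
    using Suc.IH[OF dvd_pderiv_power[OF Suc.prems]] by auto
  obtain r where r: "p = ?q ^ Suc m * r" using Suc.prems by (elim dvdE)
  have 0: "poly p 0 = 0" "poly p 1 = 0" by (simp_all add: r)
  have "\<bar>s\<bar> * cmod (poly_fourier p s) = cmod (poly_fourier (pderiv p) s)" for s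
    using arg_cong[OF poly_fourier_pderiv[OF 0, of s], of cmod] by (simp add: norm_mult)
  then have "\<bar>s\<bar> ^ Suc m * cmod (poly_fourier p s) \<le> C" for s
    using C[of s] by (simp add: mult.assoc mult.left_commute[of "\<bar>s\<bar>"])
  then show ?case by blast
qed

text \<open>A piecewise polynomial of finite smoothness: its Fourier decay is explicit, and m only
  has to exceed the Sobolev order. For m = 0 it would be constantly 1, hence the assumption m > 0
  wherever the support matters.\<close>

definition bump1 :: "nat \<Rightarrow> real \<Rightarrow> real" where
  "bump1 m t = max 0 (t * (1 - t)) ^ m"

definition fourier1 :: "(real \<Rightarrow> real) \<Rightarrow> real \<Rightarrow> complex" where
  "fourier1 f s = (LINT t|lborel. of_real (f t) * exp (- \<i> * of_real (s * t)))"

lemma continuous_bump1 [continuous_intros]: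
  "continuous_on A f \<Longrightarrow> continuous_on A (\<lambda>x. bump1 m (f x))"
  unfolding bump1_def by (intro continuous_intros)

lemma borel_measurable_bump1 [measurable]: "bump1 m \<in> borel_measurable borel"
  by (intro borel_measurable_continuous_onI continuous_intros)

lemma bump1_nonneg: "0 \<le> bump1 m t"
  by (simp add: bump1_def)

lemma bump1_le_1: "bump1 m t \<le> 1"
proof -
  have "t * (1 - t) \<le> 1"
    using sum_squares_ge_zero[of "t - 1/2" 0] by (simp add: algebra_simps power2_eq_square)
  then show ?thesis unfolding bump1_def by (intro power_le_one) auto
qed

lemma bump1_eq_0: "m > 0 \<Longrightarrow> t \<le> 0 \<or> 1 \<le> t \<Longrightarrow> bump1 m t = 0"
  by (auto simp: bump1_def max_def mult_le_0_iff zero_le_mult_iff)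

lemma bump1_pos: "0 < t \<Longrightarrow> t < 1 \<Longrightarrow> 0 < bump1 m t"
  by (auto simp: bump1_def max_def intro!: zero_less_power)

lemma fourier1_bump1:
  assumes "m > 0"
  shows "fourier1 (bump1 m) s = poly_fourier (([:0, 1:] * [:1, -1:]) ^ m) s"
proof -
  let ?p = "([:0, 1:] * [:1, -1:]) ^ m :: complex poly"
  let ?f = "\<lambda>t::real. poly ?p (of_real t) * exp (- \<i> * of_real (s * t))"
  have "of_real (bump1 m t) = indicator {0..1} t *\<^sub>R poly ?p (of_real t)" for t
  proof (cases "t \<in> {0..1}")
    case True
    then have "bump1 m t = (t * (1 - t)) ^ m" by (auto simp: bump1_def max_def mult_less_0_iff)
    then show ?thesis using True by (simp add: poly_power)
  next
    case False
    then show ?thesis using bump1_eq_0[OF assms, of t] by (auto simp: indicator_def)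
  qed
  then have "fourier1 (bump1 m) s = (LINT t:{0..1}|lborel. ?f t)"
    unfolding fourier1_def set_lebesgue_integral_def by (intro Bochner_Integration.integral_cong) auto
  also have "\<dots> = poly_fourier ?p s"
    unfolding poly_fourier_def
    by (rule set_borel_integral_eq_integral) (auto intro!: borel_integrable_atLeastAtMost' continuous_intros)
  finally show ?thesis .
qed

text \<open>Decay of order m bounds (1 + s^2)^m times the squared transform. Since m >= beta + 1,
  one factor 1 + s^2 is left after paying for the Sobolev weight; it makes the sum over all periods
  converge later.\<close>

lemma fourier1_bump1_decay:
  assumes "m > 0" "real m \<ge> \<beta> + 1" "\<beta> \<ge> 0"
  shows "\<exists>C>0. \<forall>s. (1 + s\<^sup>2) powr \<beta> * (cmod (fourier1 (bump1 m) s))\<^sup>2 \<le> C / (1 + s\<^sup>2)"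
proof -
  let ?F = "\<lambda>s. cmod (fourier1 (bump1 m) s)"
  let ?p = "([:0, 1:] * [:1, -1:]) ^ m :: complex poly"
  obtain C0 where C0: "\<And>s. ?F s \<le> C0"
    using poly_fourier_bounded[of ?p] fourier1_bump1[OF assms(1)] by auto
  obtain C1 where C1: "\<And>s. \<bar>s\<bar> ^ m * ?F s \<le> C1"
    using poly_fourier_decay[of m ?p] fourier1_bump1[OF assms(1)] by auto
  \<comment> \<open>The power of 2 comes from 1 + s^2 <= 2 for |s| <= 1 and 1 + s^2 <= 2 s^2
    otherwise; adding 1 makes the constant strictly positive.\<close>
  let ?C = "2 ^ m * (C0\<^sup>2 + C1\<^sup>2) + 1"
  have "(1 + s\<^sup>2) powr \<beta> * (?F s)\<^sup>2 \<le> ?C / (1 + s\<^sup>2)" for s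
  proof -
    have pos: "1 + s\<^sup>2 > 0" by (simp add: add_pos_nonneg)
    have "(1 + s\<^sup>2) ^ m * (?F s)\<^sup>2 \<le> 2 ^ m * (C0\<^sup>2 + C1\<^sup>2)"
    proof (cases "\<bar>s\<bar> \<le> 1")
      case True
      then have "s\<^sup>2 \<le> 1" by (simp add: abs_square_le_1)
      then have "(1 + s\<^sup>2) ^ m \<le> 2 ^ m" by (intro power_mono) auto
      moreover have "(?F s)\<^sup>2 \<le> C0\<^sup>2 + C1\<^sup>2"
        using power_mono[OF C0[of s], of 2] by (auto intro: order_trans)
      ultimately show ?thesis by (intro mult_mono) auto
    next
      case False
      then have "1 \<le> s\<^sup>2" using abs_square_less_1[of s] by (simp add: not_le not_less)
      then have "(1 + s\<^sup>2) ^ m \<le> (2 * s\<^sup>2) ^ m" by (intro power_mono) auto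
      then have "(1 + s\<^sup>2) ^ m * (?F s)\<^sup>2 \<le> (2 * s\<^sup>2) ^ m * (?F s)\<^sup>2"
        by (rule mult_right_mono) simp
      also have "\<dots> = 2 ^ m * (\<bar>s\<bar> ^ m * ?F s)\<^sup>2"
        by (simp add: power_mult_distrib power_mult[symmetric] mult.commute[of m] power_even_abs)
      also have "\<dots> \<le> 2 ^ m * (C0\<^sup>2 + C1\<^sup>2)"
        using power_mono[OF C1[of s], of 2] by (intro mult_left_mono) (auto intro: order_trans)
      finally show ?thesis .
    qed
    moreover have "(1 + s\<^sup>2) powr (\<beta> + 1) \<le> (1 + s\<^sup>2) ^ m"
      using assms pos powr_mono[of "\<beta> + 1" "real m" "1 + s\<^sup>2"] by (simp add: powr_realpow)
    then have "(1 + s\<^sup>2) powr (\<beta> + 1) * (?F s)\<^sup>2 \<le> (1 + s\<^sup>2) ^ m * (?F s)\<^sup>2"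
      by (rule mult_right_mono) simp
    ultimately have "(1 + s\<^sup>2) powr (\<beta> + 1) * (?F s)\<^sup>2 \<le> ?C" by linarith
    then show ?thesis
      using pos by (simp add: pos_le_divide_eq powr_add ac_simps)
  qed
  moreover have "?C > 0" by (simp add: add_nonneg_pos)
  ultimately show ?thesis by blast
qed

section \<open>Trigonometric sums\<close>

text \<open>Orthogonality of the characters. The period may start anywhere because the whole line
  will be tiled by periods, and the frequency is an integer because differences of frequencies
  occur.\<close>

lemma has_integral_exp_period:
  fixes k :: int
  shows "((\<lambda>t. exp (- \<i> * of_real (t * of_int k))) has_integral (if k = 0 then of_real (2 * pi) else 0)) {\<alpha>..\<alpha> + 2 * pi}"
proof (cases "k = 0")
  case True
  have "((\<lambda>_. 1::complex) has_integral (\<alpha> + 2 * pi - \<alpha>) *\<^sub>R 1) {\<alpha>..\<alpha> + 2 * pi}"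
    using has_integral_const_real[of "1::complex" \<alpha> "\<alpha> + 2 * pi"] by simp
  then show ?thesis using True by (simp add: scaleR_conv_of_real)
next
  case False
  let ?c = "- \<i> * of_int k"
  let ?F = "\<lambda>t::real. exp (?c * of_real t) / ?c"
  have c: "?c \<noteq> 0" using False by simp
  have "(?F has_vector_derivative exp (?c * of_real t)) (at t within {\<alpha>..\<alpha> + 2 * pi})" for t
  proof -
    have "((\<lambda>z. exp (?c * z) / ?c) has_field_derivative exp (?c * of_real t)) (at (of_real t))"
      using c by (auto intro!: derivative_eq_intros)
    then show ?thesis by (rule has_vector_derivative_real_field)
  qed
  then have "((\<lambda>t::real. exp (?c * of_real t)) has_integral (?F (\<alpha> + 2 * pi) - ?F \<alpha>)) {\<alpha>..\<alpha> + 2 * pi}"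
    by (intro fundamental_theorem_of_calculus) auto
  moreover have "exp (?c * of_real (\<alpha> + 2 * pi)) = exp (?c * of_real \<alpha>)"
  proof -
    have "?c * of_real (\<alpha> + 2 * pi) = ?c * of_real \<alpha> + complex_of_real (of_int (2 * (- k)) * pi) * \<i>"
      by (simp add: algebra_simps)
    then show ?thesis unfolding exp_eq by blast
  qed
  ultimately show ?thesis using False by (simp add: mult.commute mult.left_commute)
qed

text \<open>The coefficients are arbitrary complex numbers so that, in two variables, they can be
  trigonometric sums in the other variable.\<close>

definition trig_sum :: "nat \<Rightarrow> (nat \<Rightarrow> complex) \<Rightarrow> real \<Rightarrow> complex" where
  "trig_sum K c t = (\<Sum>k<K. c k * exp (- \<i> * of_real (t * real k)))"

lemma continuous_trig_sum: "continuous_on A (trig_sum K c)"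
  unfolding trig_sum_def by (intro continuous_intros)

lemma borel_measurable_trig_sum [measurable]: "trig_sum K c \<in> borel_measurable borel"
  by (intro borel_measurable_continuous_onI continuous_trig_sum)

text \<open>Expanding the square gives the frequencies k - l, and only the diagonal k = l survives
  integration.\<close>

lemma trig_sum_parseval:
  "((\<lambda>t. (cmod (trig_sum K c t))\<^sup>2) has_integral (2 * pi * (\<Sum>k<K. (cmod (c k))\<^sup>2))) {\<alpha>..\<alpha> + 2 * pi}"
proof -
  have "((\<lambda>t. \<Sum>k<K. \<Sum>l<K. (c k * cnj (c l)) * exp (- \<i> * of_real (t * of_int (int k - int l))))
      has_integral (\<Sum>k<K. \<Sum>l<K. (c k * cnj (c l)) * (if int k - int l = 0 then of_real (2 * pi) else 0))) {\<alpha>..\<alpha> + 2 * pi}"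
    by (intro has_integral_sum has_integral_mult_right has_integral_exp_period) auto
  also have "(\<lambda>t. \<Sum>k<K. \<Sum>l<K. (c k * cnj (c l)) * exp (- \<i> * of_real (t * of_int (int k - int l))))
      = (\<lambda>t. of_real ((cmod (trig_sum K c t))\<^sup>2))"
  proof
    fix t
    have "cnj (exp (- \<i> * of_real (t * real l))) = exp (\<i> * of_real (t * real l))" for l
      by (simp add: exp_cnj)
    moreover have "exp (- \<i> * of_real (t * of_int (int k - int l)))
        = exp (- \<i> * of_real (t * real k)) * exp (\<i> * of_real (t * real l))" for k l
      by (simp add: exp_add[symmetric] algebra_simps)
    ultimately show "(\<Sum>k<K. \<Sum>l<K. (c k * cnj (c l)) * exp (- \<i> * of_real (t * of_int (int k - int l))))
      = of_real ((cmod (trig_sum K c t))\<^sup>2)"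
      unfolding complex_norm_square trig_sum_def by (simp add: sum_product ac_simps)
  qed
  also have "(\<Sum>k<K. \<Sum>l<K. (c k * cnj (c l)) * (if int k - int l = 0 then of_real (2 * pi) else 0))
      = (\<Sum>k<K. \<Sum>l<K. if l = k then (c k * cnj (c k)) * of_real (2 * pi) else 0)"
    by (intro sum.cong) auto
  also have "\<dots> = of_real (2 * pi * (\<Sum>k<K. (cmod (c k))\<^sup>2))"
    by (simp add: sum_distrib_left complex_norm_square[symmetric] ac_simps)
  finally have "((\<lambda>t. of_real ((cmod (trig_sum K c t))\<^sup>2)) has_integral
      complex_of_real (2 * pi * (\<Sum>k<K. (cmod (c k))\<^sup>2))) {\<alpha>..\<alpha> + 2 * pi}" .
  from has_integral_linear[OF this bounded_linear_Re] show ?thesis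
    by (simp only: o_def Re_complex_of_real)
qed

lemma nn_integral_trig_sum_period:
  "(\<integral>\<^sup>+ t. ennreal ((cmod (trig_sum K c t))\<^sup>2) * indicator {\<alpha>..\<alpha> + 2 * pi} t \<partial>lborel)
    = ennreal (2 * pi * (\<Sum>k<K. (cmod (c k))\<^sup>2))"
proof -
  have "((\<lambda>t. (cmod (trig_sum K c t))\<^sup>2 * indicator {\<alpha>..\<alpha> + 2 * pi} t)
      has_integral (2 * pi * (\<Sum>k<K. (cmod (c k))\<^sup>2))) UNIV"
    using trig_sum_parseval[of K c \<alpha>]
    by (subst (asm) has_integral_restrict_UNIV[symmetric]) (auto elim!: has_integral_eq_rhs[rotated] has_integral_eq[rotated] simp: indicator_def)
  then show ?thesis
    by (subst nn_integral_has_integral_lborel[symmetric])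
       (auto simp: ennreal_mult' ennreal_indicator)
qed

text \<open>The line is cut into periods. On the n-th period to either side of 0 the weight is at
  most 1 / (1 + n^2), and Parseval gives the same value on each, so the constant does not depend on
  the number K of frequencies.\<close>

lemma nn_integral_trig_sum_weighted:
  "\<exists>D\<ge>0. \<forall>K c. (\<integral>\<^sup>+ t. ennreal ((cmod (trig_sum K c t))\<^sup>2 / (1 + t\<^sup>2)) \<partial>lborel)
     \<le> ennreal (D * (\<Sum>k<K. (cmod (c k))\<^sup>2))"
proof -
  have summ: "summable (\<lambda>n. 1 / (1 + (real n)\<^sup>2))"
  proof (rule summable_comparison_test')
    show "summable (\<lambda>n. 1 / (real n)\<^sup>2)"
      using inverse_power_summable[of 2, where 'a = real] by (simp add: field_simps)
    show "norm (1 / (1 + (real n)\<^sup>2)) \<le> 1 / (real n)\<^sup>2" if "n \<ge> 1" for n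
      using that by (auto intro!: divide_left_mono mult_pos_pos add_pos_nonneg)
  qed
  \<comment> \<open>2 pi from Parseval, times 2 for the two sides of the origin.\<close>
  define D where "D = 4 * pi * (\<Sum>n. 1 / (1 + (real n)\<^sup>2))"
  have "D \<ge> 0" unfolding D_def by (intro mult_nonneg_nonneg suminf_nonneg summ) auto
  have "(\<integral>\<^sup>+ t. ennreal ((cmod (trig_sum K c t))\<^sup>2 / (1 + t\<^sup>2)) \<partial>lborel)
     \<le> ennreal (D * (\<Sum>k<K. (cmod (c k))\<^sup>2))" for K c
  proof -
    let ?p = "\<lambda>t. ennreal ((cmod (trig_sum K c t))\<^sup>2)"
    let ?w = "\<lambda>n::nat. ennreal (1 / (1 + (real n)\<^sup>2))"
    let ?A = "\<lambda>\<alpha>. indicator {\<alpha>..\<alpha> + 2 * pi} :: real \<Rightarrow> ennreal"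
    \<comment> \<open>Left end points of the n-th period to the right and to the left of 0.\<close>
    let ?a = "\<lambda>n::nat. real n * (2 * pi)" and ?b = "\<lambda>n::nat. - real n * (2 * pi) - 2 * pi"
    let ?s = "\<Sum>k<K. (cmod (c k))\<^sup>2"
    have s: "?s \<ge> 0" by (simp add: sum_nonneg)
    have "(\<integral>\<^sup>+ t. ennreal ((cmod (trig_sum K c t))\<^sup>2 / (1 + t\<^sup>2)) \<partial>lborel)
      \<le> (\<integral>\<^sup>+ t. (\<Sum>n. ?w n * (?p t * ?A (?a n) t + ?p t * ?A (?b n) t)) \<partial>lborel)"
    proof (rule nn_integral_mono)
      fix t
      \<comment> \<open>The index of a period containing t. From 2 pi n <= |t| follows n <= |t|,
        which bounds the weight.\<close>
      define n where "n = nat \<lfloor>\<bar>t\<bar> / (2 * pi)\<rfloor>"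
      have n: "real n \<le> \<bar>t\<bar> / (2 * pi)" "\<bar>t\<bar> / (2 * pi) < real n + 1"
        unfolding n_def by (auto simp: floor_less_iff)
      then have n': "real n * (2 * pi) \<le> \<bar>t\<bar>" "\<bar>t\<bar> \<le> (real n + 1) * (2 * pi)"
        by (auto simp: field_simps)
      have "real n * 1 \<le> real n * (2 * pi)"
        using pi_ge_two by (intro mult_left_mono) auto
      then have "(real n)\<^sup>2 \<le> \<bar>t\<bar>\<^sup>2" using n' by (intro power_mono) auto
      then have "(cmod (trig_sum K c t))\<^sup>2 / (1 + t\<^sup>2) \<le> 1 / (1 + (real n)\<^sup>2) * (cmod (trig_sum K c t))\<^sup>2"
        by (auto intro!: divide_left_mono mult_pos_pos add_pos_nonneg)
      then have "ennreal ((cmod (trig_sum K c t))\<^sup>2 / (1 + t\<^sup>2)) \<le> ?w n * ?p t * 1"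
        by (simp add: ennreal_mult'[symmetric] ennreal_leI)
      also have "\<dots> \<le> ?w n * ?p t * (?A (?a n) t + ?A (?b n) t)"
      proof (rule mult_left_mono)
        have "t \<in> {?a n..?a n + 2 * pi} \<or> t \<in> {?b n..?b n + 2 * pi}"
          using n' by (auto simp: abs_if algebra_simps split: if_splits)
        then show "1 \<le> ?A (?a n) t + ?A (?b n) t" by (auto simp: indicator_def)
      qed simp
      also have "\<dots> = (\<Sum>k\<in>{n}. ?w k * (?p t * ?A (?a k) t + ?p t * ?A (?b k) t))"
        by (simp add: distrib_left mult.assoc)
      also have "\<dots> \<le> (\<Sum>n. ?w n * (?p t * ?A (?a n) t + ?p t * ?A (?b n) t))"
        by (rule sum_le_suminf) auto
      finally show "ennreal ((cmod (trig_sum K c t))\<^sup>2 / (1 + t\<^sup>2))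
        \<le> (\<Sum>n. ?w n * (?p t * ?A (?a n) t + ?p t * ?A (?b n) t))" .
    qed
    also have "\<dots> = (\<Sum>n. \<integral>\<^sup>+ t. ?w n * (?p t * ?A (?a n) t + ?p t * ?A (?b n) t) \<partial>lborel)"
      by (rule nn_integral_suminf) measurable
    also have "\<dots> = (\<Sum>n. ?w n * (ennreal (2 * pi * ?s) + ennreal (2 * pi * ?s)))"
      by (subst nn_integral_cmult, measurable, subst nn_integral_add, measurable)
         (simp only: nn_integral_trig_sum_period)
    also have "\<dots> = (\<Sum>n. ennreal (1 / (1 + (real n)\<^sup>2) * (4 * pi * ?s)))"
      using s by (intro suminf_cong) (simp add: ennreal_plus[symmetric] ennreal_mult'[symmetric] del: ennreal_plus)
    also have "\<dots> = ennreal (\<Sum>n. 1 / (1 + (real n)\<^sup>2) * (4 * pi * ?s))"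
      using s by (intro suminf_ennreal2 summable_mult2 summ) auto
    also have "\<dots> = ennreal (D * ?s)"
      unfolding D_def by (subst suminf_mult2[OF summ, symmetric]) (simp add: ac_simps)
    finally show ?thesis .
  qed
  then show ?thesis using \<open>D \<ge> 0\<close> by blast
qed

section \<open>Sobolev energy of sums of bumps\<close>

lemma vector2_eq: "(vector [a, b] :: real^2) = a *\<^sub>R axis 1 1 + b *\<^sub>R axis 2 1"
  by (auto simp: vec_eq_iff forall_2 axis_def)

lemma borel_measurable_vector2 [measurable]:
  assumes [measurable]: "f \<in> borel_measurable M" "g \<in> borel_measurable M"
  shows "(\<lambda>x. vector [f x, g x] :: real^2) \<in> borel_measurable M"
  unfolding vector2_eq by measurable

lemma Basis_real2: "(Basis :: (real^2) set) = {axis 1 1, axis 2 1}"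
  by (auto simp: Basis_vec_def UNIV_2)

text \<open>Transports Fubini and Tonelli from pairs to vectors; it suffices to compare the two
  measures on boxes.\<close>

lemma lborel_real2:
  "(lborel :: (real^2) measure) = distr (lborel \<Otimes>\<^sub>M lborel) borel (\<lambda>(a, b). vector [a, b])"
proof (rule lborel_eqI)
  fix l u :: "real^2" assume le: "\<And>b. b \<in> Basis \<Longrightarrow> l \<bullet> b \<le> u \<bullet> b"
  have le': "l $ 1 \<le> u $ 1" "l $ 2 \<le> u $ 2" using le[of "axis 1 1"] le[of "axis 2 1"]
    by (simp_all add: Basis_real2 inner_axis)
  have m: "(\<lambda>(a, b). vector [a, b] :: real^2) \<in> borel_measurable (lborel \<Otimes>\<^sub>M lborel)"
    by measurable
  have "(\<lambda>(a, b). vector [a, b] :: real^2) -` box l u = {l $ 1<..<u $ 1} \<times> {l $ 2<..<u $ 2}"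
    by (auto simp: mem_box_cart forall_2)
  then have "emeasure (distr (lborel \<Otimes>\<^sub>M lborel) borel (\<lambda>(a, b). vector [a, b] :: real^2)) (box l u)
      = emeasure (lborel \<Otimes>\<^sub>M lborel) ({l $ 1<..<u $ 1} \<times> {l $ 2<..<u $ 2})"
    using m by (subst emeasure_distr) (auto simp: space_pair_measure)
  also have "\<dots> = ennreal ((u $ 1 - l $ 1) * (u $ 2 - l $ 2))"
    using le' by (subst lborel.emeasure_pair_measure_Times) (auto simp: ennreal_mult)
  also have "(u $ 1 - l $ 1) * (u $ 2 - l $ 2) = (\<Prod>b\<in>Basis. (u - l) \<bullet> b)"
    by (simp add: Basis_real2 inner_axis axis_eq_axis)
  finally show "emeasure (distr (lborel \<Otimes>\<^sub>M lborel) borel (\<lambda>(a, b). vector [a, b] :: real^2)) (box l u)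
     = ennreal (\<Prod>b\<in>Basis. (u - l) \<bullet> b)" .
qed simp

lemma nn_integral_real2:
  fixes f :: "real^2 \<Rightarrow> ennreal"
  assumes [measurable]: "f \<in> borel_measurable borel"
  shows "(\<integral>\<^sup>+x. f x \<partial>lborel) = (\<integral>\<^sup>+a. \<integral>\<^sup>+b. f (vector [a, b]) \<partial>lborel \<partial>lborel)"
proof -
  have "(\<integral>\<^sup>+x. f x \<partial>lborel) = (\<integral>\<^sup>+z. f (case z of (a, b) \<Rightarrow> vector [a, b]) \<partial>(lborel \<Otimes>\<^sub>M lborel))"
    by (subst lborel_real2, subst nn_integral_distr) auto
  also have "\<dots> = (\<integral>\<^sup>+a. \<integral>\<^sup>+b. f (vector [a, b]) \<partial>lborel \<partial>lborel)"
    by (subst lborel.nn_integral_fst[symmetric]) (auto simp: case_prod_unfold)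
  finally show ?thesis .
qed

lemma integral_real2_product:
  fixes F G :: "real \<Rightarrow> complex"
  assumes F: "integrable lborel F" and G: "integrable lborel G"
  shows "integrable lborel (\<lambda>x::real^2. F (x $ 1) * G (x $ 2))"
    and "(LINT x::real^2|lborel. F (x $ 1) * G (x $ 2)) = (LINT a|lborel. F a) * (LINT b|lborel. G b)"
proof -
  have [measurable]: "F \<in> borel_measurable borel" "G \<in> borel_measurable borel"
    using F G by auto
  have [measurable]: "(\<lambda>x::real^2. F (x $ 1) * G (x $ 2)) \<in> borel_measurable borel"
  proof -
    have "(\<lambda>x::real^2. x $ i) \<in> borel_measurable borel" for i
      by (intro borel_measurable_continuous_onI continuous_intros)
    note [measurable] = this
    show ?thesis by measurable
  qed
  have i: "integrable (lborel \<Otimes>\<^sub>M lborel) (\<lambda>(a, b). F a * G b)"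
    by (rule lborel_pair.Fubini_integrable)
      (use F G in \<open>auto intro!: Bochner_Integration.integrable_mult_left integrable_norm simp: norm_mult\<close>)
  show "integrable lborel (\<lambda>x::real^2. F (x $ 1) * G (x $ 2))"
    by (subst lborel_real2, subst integrable_distr_eq) (measurable, use i in \<open>simp add: case_prod_beta'\<close>)
  have "(LINT x::real^2|lborel. F (x $ 1) * G (x $ 2))
      = (LINT z|(lborel \<Otimes>\<^sub>M lborel). (case z of (a, b) \<Rightarrow> F a * G b))"
    by (subst lborel_real2, subst integral_distr) (measurable, simp add: case_prod_beta')
  also have "\<dots> = (LINT a|lborel. LINT b|lborel. F a * G b)"
    using lborel_pair.integral_fst'[OF i] by simp
  finally show "(LINT x::real^2|lborel. F (x $ 1) * G (x $ 2)) = (LINT a|lborel. F a) * (LINT b|lborel. G b)"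
    by simp
qed

section \<open>Fourier transforms of rescaled bumps and their sums\<close>

lemma integrable_bump1_exp:
  assumes "m > 0" "h > 0"
  shows "integrable lborel (\<lambda>t. complex_of_real (bump1 m (t / h - k)) * exp (- \<i> * of_real (s * t)))"
proof -
  let ?f = "\<lambda>t. complex_of_real (bump1 m (t / h - k)) * exp (- \<i> * of_real (s * t))"
  have "integrable lborel (\<lambda>t. indicator {k * h..(k + 1) * h} t *\<^sub>R ?f t)"
    using assms by (intro borel_integrable_compact continuous_intros) auto
  also have "(\<lambda>t. indicator {k * h..(k + 1) * h} t *\<^sub>R ?f t) = ?f"
  proof
    fix t
    have "bump1 m (t / h - k) = 0" if "t \<notin> {k * h..(k + 1) * h}"
      using that assms by (intro bump1_eq_0) (auto simp: field_simps)
    then show "indicator {k * h..(k + 1) * h} t *\<^sub>R ?f t = ?f t"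
      by (auto simp: indicator_def)
  qed
  finally show ?thesis .
qed

text \<open>Substitute t = h (k + u): the position k survives only in a phase, and these phases
  become the terms of a trigonometric sum.\<close>

lemma fourier1_bump1_rescaled:
  assumes "h > 0"
  shows "fourier1 (\<lambda>t. bump1 m (t / h - k)) s
    = of_real h * exp (- \<i> * of_real (h * s * k)) * fourier1 (bump1 m) (h * s)"
proof -
  have "fourier1 (\<lambda>t. bump1 m (t / h - k)) s
      = \<bar>h\<bar> *\<^sub>R (LINT t|lborel. of_real (bump1 m ((h * k + h * t) / h - k)) * exp (- \<i> * of_real (s * (h * k + h * t))))"
    unfolding fourier1_def using assms by (subst lborel_integral_real_affine[of h _ "h * k"]) auto
  also have "(\<lambda>t. of_real (bump1 m ((h * k + h * t) / h - k)) * exp (- \<i> * of_real (s * (h * k + h * t))))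
     = (\<lambda>t. exp (- \<i> * of_real (h * s * k)) * (of_real (bump1 m t) * exp (- \<i> * of_real (h * s * t))))"
    using assms by (auto simp: fun_eq_iff field_simps exp_add[symmetric] exp_diff exp_minus)
  also have "(LINT t|lborel. exp (- \<i> * of_real (h * s * k)) * (of_real (bump1 m t) * exp (- \<i> * of_real (h * s * t))))
     = exp (- \<i> * of_real (h * s * k)) * fourier1 (bump1 m) (h * s)"
    unfolding fourier1_def by simp
  finally show ?thesis using assms by (simp add: scaleR_conv_of_real mult.assoc)
qed

text \<open>A tensor product, so that its transform factorizes. For m > 0 and h > 0 it lives on the
  square of side h with lower left corner h k.\<close>

definition bump :: "nat \<Rightarrow> real \<Rightarrow> nat \<times> nat \<Rightarrow> real^2 \<Rightarrow> real" where
  "bump m h k x = bump1 m (x $ 1 / h - real (fst k)) * bump1 m (x $ 2 / h - real (snd k))"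

definition bump_sum :: "nat \<Rightarrow> real \<Rightarrow> real \<Rightarrow> (nat \<times> nat) set \<Rightarrow> real^2 \<Rightarrow> real" where
  "bump_sum m h a S x = a * (\<Sum>k\<in>S. bump m h k x)"

lemma fourier_transform_bump:
  assumes "m > 0" "h > 0"
  shows "integrable lborel (\<lambda>x::real^2. complex_of_real (bump m h k x) * exp (- \<i> * of_real (\<xi> \<bullet> x)))"
    and "fourier_transform (bump m h k) \<xi> =
      fourier1 (\<lambda>t. bump1 m (t / h - real (fst k))) (\<xi> $ 1) * fourier1 (\<lambda>t. bump1 m (t / h - real (snd k))) (\<xi> $ 2)"
proof -
  have eq: "(\<lambda>x::real^2. complex_of_real (bump m h k x) * exp (- \<i> * of_real (\<xi> \<bullet> x)))
    = (\<lambda>x. (of_real (bump1 m (x $ 1 / h - real (fst k))) * exp (- \<i> * of_real (\<xi> $ 1 * x $ 1)))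
        * (of_real (bump1 m (x $ 2 / h - real (snd k))) * exp (- \<i> * of_real (\<xi> $ 2 * x $ 2))))"
    by (simp add: fun_eq_iff bump_def inner_vec_def sum_2 exp_add[symmetric] algebra_simps)
  note i = integrable_bump1_exp[OF assms]
  show "integrable lborel (\<lambda>x::real^2. complex_of_real (bump m h k x) * exp (- \<i> * of_real (\<xi> \<bullet> x)))"
    unfolding eq by (rule integral_real2_product(1)[OF i i])
  show "fourier_transform (bump m h k) \<xi> =
      fourier1 (\<lambda>t. bump1 m (t / h - real (fst k))) (\<xi> $ 1) * fourier1 (\<lambda>t. bump1 m (t / h - real (snd k))) (\<xi> $ 2)"
    unfolding fourier_transform_def fourier1_def eq by (rule integral_real2_product(2)[OF i i])
qed

text \<open>The phases of all bumps in S after rescaling: a trigonometric polynomial in two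
  variables whose coefficients are the indicator of S.\<close>

definition lattice_sum :: "(nat \<times> nat) set \<Rightarrow> real \<Rightarrow> real \<Rightarrow> complex" where
  "lattice_sum S s t = (\<Sum>k\<in>S. exp (- \<i> * of_real (s * real (fst k))) * exp (- \<i> * of_real (t * real (snd k))))"

lemma fourier_transform_bump_sum:
  assumes "m > 0" "h > 0"
  shows "fourier_transform (bump_sum m h a S) \<xi> =
    of_real (a * h\<^sup>2) * fourier1 (bump1 m) (h * \<xi> $ 1) * fourier1 (bump1 m) (h * \<xi> $ 2)
      * lattice_sum S (h * \<xi> $ 1) (h * \<xi> $ 2)"
proof -
  have "fourier_transform (bump_sum m h a S) \<xi>
    = (LINT x|lborel. of_real a * (\<Sum>k\<in>S. complex_of_real (bump m h k x) * exp (- \<i> * of_real (\<xi> \<bullet> x))))"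
    unfolding fourier_transform_def bump_sum_def
    by (intro Bochner_Integration.integral_cong) (simp_all add: sum_distrib_right sum_distrib_left mult.assoc)
  also have "\<dots> = of_real a * (\<Sum>k\<in>S. fourier_transform (bump m h k) \<xi>)"
    unfolding fourier_transform_def
    using fourier_transform_bump(1)[OF assms] by (simp add: Bochner_Integration.integral_sum)
  also have "\<dots> = of_real a * (\<Sum>k\<in>S. (of_real h)\<^sup>2 * fourier1 (bump1 m) (h * \<xi> $ 1) * fourier1 (bump1 m) (h * \<xi> $ 2)
      * (exp (- \<i> * of_real (h * \<xi> $ 1 * real (fst k))) * exp (- \<i> * of_real (h * \<xi> $ 2 * real (snd k)))))"
    unfolding fourier_transform_bump(2)[OF assms] fourier1_bump1_rescaled[OF assms(2)]
    by (simp add: power2_eq_square ac_simps)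
  finally show ?thesis
    by (simp add: lattice_sum_def sum_distrib_left[symmetric] mult.assoc)
qed

text \<open>The one-dimensional estimate is used twice, first in t with coefficients depending on s,
  then in s for each coefficient. Coefficients of modulus at most 1 on a K by K grid give
  K^2.\<close>

lemma lattice_sum_weighted:
  "\<exists>D\<ge>0. \<forall>K S. S \<subseteq> {..<K} \<times> {..<K} \<longrightarrow>
    (\<integral>\<^sup>+s. \<integral>\<^sup>+t. ennreal ((cmod (lattice_sum S s t))\<^sup>2 / (1 + s\<^sup>2) / (1 + t\<^sup>2)) \<partial>lborel \<partial>lborel)
      \<le> ennreal (D * (real K)\<^sup>2)"
proof -
  obtain D where D: "D \<ge> 0" and trig: "\<And>K c. (\<integral>\<^sup>+ t. ennreal ((cmod (trig_sum K c t))\<^sup>2 / (1 + t\<^sup>2)) \<partial>lborel)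
     \<le> ennreal (D * (\<Sum>k<K. (cmod (c k))\<^sup>2))"
    using nn_integral_trig_sum_weighted by blast
  have "(\<integral>\<^sup>+s. \<integral>\<^sup>+t. ennreal ((cmod (lattice_sum S s t))\<^sup>2 / (1 + s\<^sup>2) / (1 + t\<^sup>2)) \<partial>lborel \<partial>lborel)
      \<le> ennreal (D * D * (real K)\<^sup>2)" if S: "S \<subseteq> {..<K} \<times> {..<K}" for K S
  proof -
    \<comment> \<open>Coefficient of the l-th frequency in t: row l of the indicator of S, summed
      against the phases in s.\<close>
    define c where "c l s = trig_sum K (\<lambda>k. of_bool ((k, l) \<in> S)) s" for l s
    have [measurable]: "c l \<in> borel_measurable borel" for l
      unfolding c_def by simp
    have P: "lattice_sum S s t = trig_sum K (\<lambda>l. c l s) t" for s t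
    proof -
      have "lattice_sum S s t = (\<Sum>k\<in>{..<K} \<times> {..<K}. of_bool (k \<in> S) *
          (exp (- \<i> * of_real (s * real (fst k))) * exp (- \<i> * of_real (t * real (snd k)))))"
        unfolding lattice_sum_def using S by (intro sum.mono_neutral_cong_left) auto
      also have "\<dots> = (\<Sum>k<K. \<Sum>l<K. of_bool ((k, l) \<in> S) *
          (exp (- \<i> * of_real (s * real k)) * exp (- \<i> * of_real (t * real l))))"
        by (simp only: sum.cartesian_product case_prod_unfold prod.collapse)
      also have "\<dots> = (\<Sum>l<K. \<Sum>k<K. of_bool ((k, l) \<in> S) *
          (exp (- \<i> * of_real (s * real k)) * exp (- \<i> * of_real (t * real l))))"
        by (rule sum.swap)
      finally show ?thesis
        by (simp add: trig_sum_def c_def sum_distrib_right mult.assoc)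
    qed
    have "(\<integral>\<^sup>+t. ennreal ((cmod (lattice_sum S s t))\<^sup>2 / (1 + s\<^sup>2) / (1 + t\<^sup>2)) \<partial>lborel)
        \<le> (\<Sum>l<K. ennreal D * ennreal ((cmod (c l s))\<^sup>2 / (1 + s\<^sup>2)))" for s
    proof -
      have pos: "1 / (1 + s\<^sup>2) \<ge> 0" by simp
      have "(\<integral>\<^sup>+t. ennreal ((cmod (lattice_sum S s t))\<^sup>2 / (1 + s\<^sup>2) / (1 + t\<^sup>2)) \<partial>lborel)
        = (\<integral>\<^sup>+t. ennreal (1 / (1 + s\<^sup>2)) * ennreal ((cmod (trig_sum K (\<lambda>l. c l s) t))\<^sup>2 / (1 + t\<^sup>2)) \<partial>lborel)"
        using pos by (intro nn_integral_cong) (simp add: P ennreal_mult'[symmetric] ac_simps)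
      also have "\<dots> = ennreal (1 / (1 + s\<^sup>2)) * (\<integral>\<^sup>+t. ennreal ((cmod (trig_sum K (\<lambda>l. c l s) t))\<^sup>2 / (1 + t\<^sup>2)) \<partial>lborel)"
        by (rule nn_integral_cmult) measurable
      also have "\<dots> \<le> ennreal (1 / (1 + s\<^sup>2)) * ennreal (D * (\<Sum>l<K. (cmod (c l s))\<^sup>2))"
        by (intro mult_left_mono trig) simp
      also have "\<dots> = ennreal (\<Sum>l<K. D * ((cmod (c l s))\<^sup>2 / (1 + s\<^sup>2)))"
        using pos by (subst ennreal_mult'[symmetric]) (simp_all add: sum_distrib_left sum_divide_distrib)
      also have "\<dots> = (\<Sum>l<K. ennreal (D * ((cmod (c l s))\<^sup>2 / (1 + s\<^sup>2))))"
        using D by (intro sum_ennreal[symmetric]) auto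
      finally show ?thesis by (simp only: ennreal_mult'[OF D])
    qed
    then have "(\<integral>\<^sup>+s. \<integral>\<^sup>+t. ennreal ((cmod (lattice_sum S s t))\<^sup>2 / (1 + s\<^sup>2) / (1 + t\<^sup>2)) \<partial>lborel \<partial>lborel)
      \<le> (\<integral>\<^sup>+s. (\<Sum>l<K. ennreal D * ennreal ((cmod (c l s))\<^sup>2 / (1 + s\<^sup>2))) \<partial>lborel)"
      by (intro nn_integral_mono)
    also have "\<dots> = (\<Sum>l<K. ennreal D * (\<integral>\<^sup>+s. ennreal ((cmod (c l s))\<^sup>2 / (1 + s\<^sup>2)) \<partial>lborel))"
      by (subst nn_integral_sum) (measurable, simp add: nn_integral_cmult)
    also have "\<dots> \<le> (\<Sum>l<K. ennreal D * ennreal (D * (\<Sum>k<K. (cmod (of_bool ((k, l) \<in> S)))\<^sup>2)))"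
      unfolding c_def by (intro sum_mono mult_left_mono trig) auto
    also have "\<dots> \<le> (\<Sum>l<K. ennreal D * ennreal (D * real K))"
    proof (intro sum_mono mult_left_mono ennreal_leI D)
      fix l
      have "(\<Sum>k<K. (cmod (of_bool ((k, l) \<in> S)))\<^sup>2) \<le> (\<Sum>k<K. 1)"
        by (intro sum_mono) auto
      then show "(\<Sum>k<K. (cmod (of_bool ((k, l) \<in> S)))\<^sup>2) \<le> real K" by simp
    qed simp
    also have "\<dots> = ennreal (D * D * (real K)\<^sup>2)"
      using D by (simp add: ennreal_mult'[symmetric] ennreal_of_nat_eq_real_of_nat power2_eq_square ac_simps)
    finally show ?thesis .
  qed
  then show ?thesis using D by (intro exI[of _ "D * D"]) auto
qed

lemma nn_integral_real_scale2:
  fixes g :: "real \<Rightarrow> real \<Rightarrow> ennreal"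
  assumes [measurable]: "case_prod g \<in> borel_measurable (borel \<Otimes>\<^sub>M borel)" and "h > 0"
  shows "ennreal (h\<^sup>2) * (\<integral>\<^sup>+s. \<integral>\<^sup>+t. g (h * s) (h * t) \<partial>lborel \<partial>lborel) = (\<integral>\<^sup>+s. \<integral>\<^sup>+t. g s t \<partial>lborel \<partial>lborel)"
proof -
  have "(\<lambda>z. case_prod g (h * fst z, h * snd z)) \<in> borel_measurable (lborel \<Otimes>\<^sub>M lborel)"
    by measurable
  then have m: "(\<lambda>s. \<integral>\<^sup>+t. g (h * s) (h * t) \<partial>lborel) \<in> borel_measurable lborel"
    using lborel.borel_measurable_nn_integral[of "\<lambda>s t. g (h * s) (h * t)" lborel] by (simp add: case_prod_unfold)
  have t: "(\<integral>\<^sup>+t. g s t \<partial>lborel) = ennreal h * (\<integral>\<^sup>+t. g s (h * t) \<partial>lborel)" for s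
    using assms(2) by (subst nn_integral_real_affine[of _ h 0]) auto
  have "(\<integral>\<^sup>+s. \<integral>\<^sup>+t. g s t \<partial>lborel \<partial>lborel) = ennreal h * (\<integral>\<^sup>+s. \<integral>\<^sup>+t. g (h * s) t \<partial>lborel \<partial>lborel)"
    using assms(2) by (subst nn_integral_real_affine[of _ h 0]) auto
  also have "\<dots> = ennreal h * (\<integral>\<^sup>+s. ennreal h * (\<integral>\<^sup>+t. g (h * s) (h * t) \<partial>lborel) \<partial>lborel)"
    by (simp only: t)
  also have "\<dots> = ennreal h * (ennreal h * (\<integral>\<^sup>+s. \<integral>\<^sup>+t. g (h * s) (h * t) \<partial>lborel \<partial>lborel))"
    by (subst nn_integral_cmult[OF m]) simp
  finally show ?thesis
    using assms(2) by (simp add: mult.assoc[symmetric] ennreal_mult'[symmetric] power2_eq_square)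
qed

text \<open>The powers of h: h^4 from the squared transform, h^(- 2 beta) from the Sobolev weight
  and h^(- 2) from the substitution in the frequency. With K^2 from the lattice sum, what remains is
  (h K)^2, the area of the grid.\<close>

lemma bump_sum_sobolev_energy:
  assumes "m > 0" "real m \<ge> \<beta> + 1" "\<beta> \<ge> 0"
  shows "\<exists>C\<ge>0. \<forall>h a K S. 0 < h \<longrightarrow> h \<le> 1 \<longrightarrow> S \<subseteq> {..<K} \<times> {..<K} \<longrightarrow>
    (\<integral>\<^sup>+ \<xi>. ennreal ((1 + (norm \<xi>)\<^sup>2) powr \<beta> * (cmod (fourier_transform (bump_sum m h a S) \<xi>))\<^sup>2) \<partial>lborel)
      \<le> ennreal (C * (a\<^sup>2 * h powr (- 2 * \<beta>) * (h * real K)\<^sup>2))"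
proof -
  let ?F = "\<lambda>s. cmod (fourier1 (bump1 m) s)"
  obtain C where C: "C > 0" "\<And>s. (1 + s\<^sup>2) powr \<beta> * (?F s)\<^sup>2 \<le> C / (1 + s\<^sup>2)"
    using fourier1_bump1_decay[OF assms] by blast
  obtain D where D: "D \<ge> 0" "\<And>K S. S \<subseteq> {..<K} \<times> {..<K} \<Longrightarrow>
    (\<integral>\<^sup>+s. \<integral>\<^sup>+t. ennreal ((cmod (lattice_sum S s t))\<^sup>2 / (1 + s\<^sup>2) / (1 + t\<^sup>2)) \<partial>lborel \<partial>lborel)
      \<le> ennreal (D * (real K)\<^sup>2)"
    using lattice_sum_weighted by blast
  have "(\<integral>\<^sup>+ \<xi>. ennreal ((1 + (norm \<xi>)\<^sup>2) powr \<beta> * (cmod (fourier_transform (bump_sum m h a S) \<xi>))\<^sup>2) \<partial>lborel)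
      \<le> ennreal (C\<^sup>2 * D * (a\<^sup>2 * h powr (- 2 * \<beta>) * (h * real K)\<^sup>2))"
    if h: "0 < h" "h \<le> 1" and S: "S \<subseteq> {..<K} \<times> {..<K}" for h a K S
  proof -
    let ?c = "a\<^sup>2 * h ^ 4 * h powr (- 2 * \<beta>) * C\<^sup>2"
    let ?g = "\<lambda>s t. ennreal ((cmod (lattice_sum S s t))\<^sup>2 / (1 + s\<^sup>2) / (1 + t\<^sup>2))"
    have c: "?c \<ge> 0" by simp
    \<comment> \<open>One factor h^2 is set aside for the Jacobian of the rescaling.\<close>
    have split_c: "ennreal ?c = ennreal (a\<^sup>2 * h\<^sup>2 * h powr (- 2 * \<beta>) * C\<^sup>2) * ennreal (h\<^sup>2)"
      by (subst ennreal_mult'[symmetric]) (simp, simp add: power2_eq_square power4_eq_xxxx ac_simps)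
    have [measurable]: "(\<lambda>x::real^2. x $ i) \<in> borel_measurable borel" for i
      by (intro borel_measurable_continuous_onI continuous_intros)
    have g[measurable]: "case_prod ?g \<in> borel_measurable (borel \<Otimes>\<^sub>M borel)"
      unfolding lattice_sum_def by measurable
    have gx[measurable]: "(\<lambda>\<xi>::real^2. ?g (h * \<xi> $ 1) (h * \<xi> $ 2)) \<in> borel_measurable borel"
      unfolding lattice_sum_def by measurable
    have pt: "(1 + (norm \<xi>)\<^sup>2) powr \<beta> * (cmod (fourier_transform (bump_sum m h a S) \<xi>))\<^sup>2
      \<le> ?c * ((cmod (lattice_sum S (h * \<xi> $ 1) (h * \<xi> $ 2)))\<^sup>2 / (1 + (h * \<xi> $ 1)\<^sup>2) / (1 + (h * \<xi> $ 2)\<^sup>2))" for \<xi>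
    proof -
      let ?s = "h * \<xi> $ 1" and ?t = "h * \<xi> $ 2"
      let ?P = "(cmod (lattice_sum S ?s ?t))\<^sup>2"
      have n: "(norm \<xi>)\<^sup>2 = (\<xi> $ 1)\<^sup>2 + (\<xi> $ 2)\<^sup>2"
        by (simp add: norm_vec_def L2_set_def sum_2)
      \<comment> \<open>In rescaled frequencies the isotropic weight is bounded by a product weight,
        matching the tensor structure of the bump; h <= 1 enters here.\<close>
      have "h\<^sup>2 * (1 + (norm \<xi>)\<^sup>2) = h\<^sup>2 + (?s\<^sup>2 + ?t\<^sup>2)"
        by (simp add: n algebra_simps power_mult_distrib)
      also have "\<dots> \<le> 1 + (?s\<^sup>2 + ?t\<^sup>2)"
        using h by (intro add_right_mono) (simp add: power_le_one)
      also have "\<dots> \<le> 1 + (?s\<^sup>2 + ?t\<^sup>2) + ?s\<^sup>2 * ?t\<^sup>2"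
        by simp
      also have "\<dots> = (1 + ?s\<^sup>2) * (1 + ?t\<^sup>2)"
        by (simp add: algebra_simps)
      finally have "1 + (norm \<xi>)\<^sup>2 \<le> h powr (- 2) * ((1 + ?s\<^sup>2) * (1 + ?t\<^sup>2))"
        using h by (simp add: powr_minus_divide pos_le_divide_eq mult.commute)
      then have "(1 + (norm \<xi>)\<^sup>2) powr \<beta> \<le> (h powr (- 2) * ((1 + ?s\<^sup>2) * (1 + ?t\<^sup>2))) powr \<beta>"
        using assms(3) by (intro powr_mono2) auto
      also have "\<dots> = h powr (- 2 * \<beta>) * ((1 + ?s\<^sup>2) powr \<beta> * (1 + ?t\<^sup>2) powr \<beta>)"
        by (simp add: powr_mult powr_powr)
      finally have w: "(1 + (norm \<xi>)\<^sup>2) powr \<beta> \<le> h powr (- 2 * \<beta>) * ((1 + ?s\<^sup>2) powr \<beta> * (1 + ?t\<^sup>2) powr \<beta>)" .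
      have f: "(cmod (fourier_transform (bump_sum m h a S) \<xi>))\<^sup>2 = a\<^sup>2 * h ^ 4 * ((?F ?s)\<^sup>2 * (?F ?t)\<^sup>2) * ?P"
        unfolding fourier_transform_bump_sum[OF assms(1) h(1)] norm_mult norm_of_real power_mult_distrib
        by (simp add: power_mult_distrib power_mult[symmetric])
      have "(1 + (norm \<xi>)\<^sup>2) powr \<beta> * (cmod (fourier_transform (bump_sum m h a S) \<xi>))\<^sup>2
        \<le> h powr (- 2 * \<beta>) * ((1 + ?s\<^sup>2) powr \<beta> * (1 + ?t\<^sup>2) powr \<beta>) * (a\<^sup>2 * h ^ 4 * ((?F ?s)\<^sup>2 * (?F ?t)\<^sup>2) * ?P)"
        unfolding f by (intro mult_right_mono w) auto
      also have "\<dots> = a\<^sup>2 * h ^ 4 * h powr (- 2 * \<beta>) * ?P * (((1 + ?s\<^sup>2) powr \<beta> * (?F ?s)\<^sup>2) * ((1 + ?t\<^sup>2) powr \<beta> * (?F ?t)\<^sup>2))"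
        by (simp only: ac_simps)
      also have "\<dots> \<le> a\<^sup>2 * h ^ 4 * h powr (- 2 * \<beta>) * ?P * ((C / (1 + ?s\<^sup>2)) * (C / (1 + ?t\<^sup>2)))"
        using C by (intro mult_left_mono mult_mono) auto
      finally show ?thesis by (simp add: power2_eq_square ac_simps)
    qed
    have "(\<integral>\<^sup>+ \<xi>. ennreal ((1 + (norm \<xi>)\<^sup>2) powr \<beta> * (cmod (fourier_transform (bump_sum m h a S) \<xi>))\<^sup>2) \<partial>lborel)
      \<le> (\<integral>\<^sup>+ \<xi>. ennreal ?c * ?g (h * \<xi> $ 1) (h * \<xi> $ 2) \<partial>(lborel :: (real^2) measure))"
      using pt c by (intro nn_integral_mono) (simp add: ennreal_mult'[symmetric] ennreal_leI)
    also have "\<dots> = ennreal ?c * (\<integral>\<^sup>+ \<xi>. ?g (h * \<xi> $ 1) (h * \<xi> $ 2) \<partial>(lborel :: (real^2) measure))"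
      by (rule nn_integral_cmult) measurable
    also have "\<dots> = ennreal ?c * (\<integral>\<^sup>+s. \<integral>\<^sup>+t. ?g (h * s) (h * t) \<partial>lborel \<partial>lborel)"
      by (subst nn_integral_real2[OF gx]) simp
    also have "\<dots> = ennreal (a\<^sup>2 * h\<^sup>2 * h powr (- 2 * \<beta>) * C\<^sup>2) * (ennreal (h\<^sup>2) * (\<integral>\<^sup>+s. \<integral>\<^sup>+t. ?g (h * s) (h * t) \<partial>lborel \<partial>lborel))"
      unfolding split_c by (rule mult.assoc)
    also have "\<dots> = ennreal (a\<^sup>2 * h\<^sup>2 * h powr (- 2 * \<beta>) * C\<^sup>2) * (\<integral>\<^sup>+s. \<integral>\<^sup>+t. ?g s t \<partial>lborel \<partial>lborel)"
      by (subst nn_integral_real_scale2[OF g h(1)]) simp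
    also have "\<dots> \<le> ennreal (a\<^sup>2 * h\<^sup>2 * h powr (- 2 * \<beta>) * C\<^sup>2) * ennreal (D * (real K)\<^sup>2)"
      by (intro mult_left_mono D S) simp
    also have "\<dots> = ennreal (C\<^sup>2 * D * (a\<^sup>2 * h powr (- 2 * \<beta>) * (h * real K)\<^sup>2))"
      by (subst ennreal_mult'[symmetric]) (simp, simp add: power_mult_distrib ac_simps)
    finally show ?thesis .
  qed
  then show ?thesis using D(1) by (intro exI[of _ "C\<^sup>2 * D"]) auto
qed

section \<open>Exponential Radon transform of a bump\<close>

lemma rot90_inner:
  assumes "norm \<theta> = 1"
  shows "(s *\<^sub>R \<theta> + t *\<^sub>R rot90 \<theta>) \<bullet> \<theta> = s" "(s *\<^sub>R \<theta> + t *\<^sub>R rot90 \<theta>) \<bullet> rot90 \<theta> = t"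
    "norm (rot90 \<theta>) = 1" "norm (s *\<^sub>R \<theta> + t *\<^sub>R rot90 \<theta>) ^ 2 = s\<^sup>2 + t\<^sup>2"
proof -
  have 1: "\<theta> \<bullet> \<theta> = 1" using assms by (simp add: norm_eq_1)
  have 2: "rot90 \<theta> \<bullet> \<theta> = 0" "\<theta> \<bullet> rot90 \<theta> = 0"
    by (simp_all add: rot90_def inner_vec_def sum_2)
  have 3: "rot90 \<theta> \<bullet> rot90 \<theta> = 1"
    using 1 by (simp add: rot90_def inner_vec_def sum_2)
  show "(s *\<^sub>R \<theta> + t *\<^sub>R rot90 \<theta>) \<bullet> \<theta> = s" "(s *\<^sub>R \<theta> + t *\<^sub>R rot90 \<theta>) \<bullet> rot90 \<theta> = t"
    "norm (rot90 \<theta>) = 1"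
    using 1 2 3 by (simp_all add: inner_add_left norm_eq_1)
  show "norm (s *\<^sub>R \<theta> + t *\<^sub>R rot90 \<theta>) ^ 2 = s\<^sup>2 + t\<^sup>2"
    unfolding power2_norm_eq_inner using 1 2 3
    by (simp add: inner_add_left inner_add_right power2_eq_square)
qed

lemma exp_radon_unit:
  assumes "norm \<theta> = 1"
  shows "exp_radon \<mu> f (\<theta>, s) = (LINT t|lborel. exp (\<mu> * t) * f (s *\<^sub>R \<theta> + t *\<^sub>R rot90 \<theta>))"
  using rot90_inner[OF assms] by (simp add: exp_radon_def Let_def)

text \<open>The point of the line with parameter t has squared norm s^2 + t^2, so the integrand
  vanishes for |t| > 1 and continuity on [-1, 1] suffices.\<close>

lemma exp_radon_integrable:
  assumes f: "continuous_on UNIV f" "\<And>x. x \<notin> cball 0 1 \<Longrightarrow> f x = 0" and "norm \<theta> = 1"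
  shows "integrable lborel (\<lambda>t. exp (\<mu> * t) * f (s *\<^sub>R \<theta> + t *\<^sub>R rot90 \<theta>))"
proof -
  let ?f = "\<lambda>t. exp (\<mu> * t) * f (s *\<^sub>R \<theta> + t *\<^sub>R rot90 \<theta>)"
  have "integrable lborel (\<lambda>t. indicator {-1..1} t *\<^sub>R ?f t)"
    by (intro borel_integrable_compact continuous_intros continuous_on_compose2[OF f(1)]) auto
  also have "(\<lambda>t. indicator {-1..1} t *\<^sub>R ?f t) = ?f"
  proof
    fix t
    have "f (s *\<^sub>R \<theta> + t *\<^sub>R rot90 \<theta>) = 0" if "t \<notin> {-1..1}"
    proof (rule f(2))
      have "1\<^sup>2 < \<bar>t\<bar>\<^sup>2" using that by (intro power_strict_mono) auto
      then have "1\<^sup>2 < norm (s *\<^sub>R \<theta> + t *\<^sub>R rot90 \<theta>) ^ 2"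
        using rot90_inner(4)[OF assms(3), of s t] by (simp add: add_nonneg_pos add_strict_increasing2)
      then have "1 < norm (s *\<^sub>R \<theta> + t *\<^sub>R rot90 \<theta>)"
        by (rule power_less_imp_less_base) simp
      then show "s *\<^sub>R \<theta> + t *\<^sub>R rot90 \<theta> \<notin> cball 0 1" by simp
    qed
    then show "indicator {-1..1} t *\<^sub>R ?f t = ?f t" by (auto simp: indicator_def)
  qed
  finally show ?thesis .
qed

lemma continuous_bump: "continuous_on A (bump m h k)"
  unfolding bump_def by (cases "h = 0") (auto intro!: continuous_intros)

lemma continuous_bump_sum: "continuous_on A (bump_sum m h a S)"
  unfolding bump_sum_def by (intro continuous_intros continuous_bump)

lemma bump_nonneg: "0 \<le> bump m h k x"
  by (simp add: bump_def bump1_nonneg)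

lemma bump_le_1: "bump m h k x \<le> 1"
  using mult_mono[OF bump1_le_1 bump1_le_1, of _ _ m] by (simp add: bump_def bump1_nonneg)

text \<open>Open squares, so that distinct cells are strictly disjoint; for m > 0 the bumps vanish
  on the boundaries.\<close>

definition cell :: "real \<Rightarrow> nat \<times> nat \<Rightarrow> (real^2) set" where
  "cell h k = {x. real (fst k) * h < x $ 1 \<and> x $ 1 < (real (fst k) + 1) * h \<and>
                  real (snd k) * h < x $ 2 \<and> x $ 2 < (real (snd k) + 1) * h}"

lemma bump_eq_0:
  assumes "m > 0" "h > 0" "x \<notin> cell h k"
  shows "bump m h k x = 0"
proof -
  have z: "bump1 m (t / h - j) = 0" if "\<not> (j * h < t \<and> t < (j + 1) * h)" for t j
    using that assms by (intro bump1_eq_0) (auto simp: field_simps)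
  have "bump1 m (x $ 1 / h - real (fst k)) = 0 \<or> bump1 m (x $ 2 / h - real (snd k)) = 0"
    using assms(3) z unfolding cell_def by blast
  then show ?thesis by (auto simp: bump_def)
qed

lemma cell_disjoint:
  assumes "x \<in> cell h k" "x \<in> cell h l"
  shows "k = l"
proof -
  have *: "i \<le> j" if "real i * h < t" "t < (real j + 1) * h" "h > 0" for i j :: nat and t
  proof -
    have "real i * h < (real j + 1) * h" using that by linarith
    then have "real i < real j + 1" using that(3) by simp
    then show ?thesis by linarith
  qed
  \<comment> \<open>Forced by the cell being nonempty.\<close>
  have "h > 0"
  proof -
    have "real (fst k) * h < (real (fst k) + 1) * h" using assms by (auto simp: cell_def)
    then show ?thesis by (simp add: algebra_simps)
  qed
  then have "fst k = fst l" "snd k = snd l"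
    using assms *[of "fst k" "x $ 1" "fst l"] *[of "fst l" "x $ 1" "fst k"]
      *[of "snd k" "x $ 2" "snd l"] *[of "snd l" "x $ 2" "snd k"]
    by (auto simp: cell_def intro: antisym)
  then show ?thesis by (simp add: prod_eq_iff)
qed

text \<open>The grid lies in [0, 1/2]^2, where the sum of the coordinates is at most 1 and dominates
  the Euclidean norm. This is the reason for the bound 1/2.\<close>

lemma cell_subset_cball:
  assumes "h > 0" "real K * h \<le> 1 / 2" "k \<in> {..<K} \<times> {..<K}"
  shows "cell h k \<subseteq> cball 0 1"
proof
  fix x assume x: "x \<in> cell h k"
  have *: "0 \<le> t \<and> t \<le> 1 / 2" if "real j * h < t" "t < (real j + 1) * h" "j < K" for j t
  proof -
    have "0 \<le> real j * h" using assms(1) by simp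
    moreover have "(real j + 1) * h \<le> real K * h"
      using that assms(1) by (intro mult_right_mono) auto
    ultimately show ?thesis using that assms(2) by linarith
  qed
  have "norm x \<le> (\<Sum>i\<in>UNIV. \<bar>x $ i\<bar>)" by (rule norm_le_l1_cart)
  also have "\<dots> = \<bar>x $ 1\<bar> + \<bar>x $ 2\<bar>" by (simp add: sum_2)
  also have "\<dots> \<le> 1"
    using x assms(3) *[of "fst k" "x $ 1"] *[of "snd k" "x $ 2"] by (auto simp: cell_def)
  finally show "x \<in> cball 0 1" by simp
qed

lemma bump_eq_0_outside_cball:
  assumes "m > 0" "h > 0" "real K * h \<le> 1 / 2" "k \<in> {..<K} \<times> {..<K}" "x \<notin> cball 0 1"
  shows "bump m h k x = 0"
  using bump_eq_0[OF assms(1,2)] cell_subset_cball[OF assms(2-4)] assms(5) by blast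

lemma cell_diameter:
  assumes "h > 0" "x \<in> cell h k"
  shows "norm (x - vector [real (fst k) * h, real (snd k) * h]) \<le> 2 * h"
proof -
  let ?y = "vector [real (fst k) * h, real (snd k) * h] :: real^2"
  have "norm (x - ?y) \<le> (\<Sum>i\<in>UNIV. \<bar>(x - ?y) $ i\<bar>)" by (rule norm_le_l1_cart)
  also have "\<dots> \<le> 2 * h" using assms by (auto simp: cell_def sum_2 algebra_simps)
  finally show ?thesis .
qed

text \<open>By Cauchy-Schwarz against the orthonormal frame of the line, a point in a cell has both
  s and t within 2 h of the coordinates of the corner. So only a strip of offsets s is affected, and
  on each such line only a segment of length 4 h, where |t| <= 1 bounds the exponential
  weight.\<close>

lemma exp_radon_bump_bound:
  assumes "m > 0" "h > 0" "real K * h \<le> 1 / 2" "k \<in> {..<K} \<times> {..<K}" "norm \<theta> = 1"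
  shows "\<bar>exp_radon \<mu> (bump m h k) (\<theta>, s)\<bar>
    \<le> exp \<bar>\<mu>\<bar> * (4 * h) * indicator {s. \<bar>s - vector [real (fst k) * h, real (snd k) * h] \<bullet> \<theta>\<bar> \<le> 2 * h} s"
proof -
  let ?y = "vector [real (fst k) * h, real (snd k) * h] :: real^2"
  let ?x = "\<lambda>t. s *\<^sub>R \<theta> + t *\<^sub>R rot90 \<theta>"
  let ?I = "{s. \<bar>s - ?y \<bullet> \<theta>\<bar> \<le> 2 * h}"
  let ?J = "{?y \<bullet> rot90 \<theta> - 2 * h..?y \<bullet> rot90 \<theta> + 2 * h}"
  note r = rot90_inner[OF assms(5)]
  have supp: "x \<notin> cball 0 1 \<Longrightarrow> bump m h k x = 0" for x
    by (rule bump_eq_0_outside_cball[OF assms(1-4)])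
  have int: "integrable lborel (\<lambda>t. exp (\<mu> * t) * bump m h k (?x t))"
    by (rule exp_radon_integrable[OF continuous_bump supp assms(5)])
  have pt: "\<bar>exp (\<mu> * t) * bump m h k (?x t)\<bar> \<le> exp \<bar>\<mu>\<bar> * indicator ?I s * indicator ?J t" for t
  proof (cases "?x t \<in> cell h k")
    case False
    then show ?thesis using assms by (simp add: bump_eq_0)
  next
    case True
    have d: "norm (?x t - ?y) \<le> 2 * h" by (rule cell_diameter[OF assms(2) True])
    have "\<bar>(?x t - ?y) \<bullet> \<theta>\<bar> \<le> 2 * h"
      using Cauchy_Schwarz_ineq2[of "?x t - ?y" \<theta>] d assms(5) by simp
    then have 1: "s \<in> ?I" using r(1)[of s t] by (simp add: inner_diff_left)
    have "\<bar>(?x t - ?y) \<bullet> rot90 \<theta>\<bar> \<le> 2 * h"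
      using Cauchy_Schwarz_ineq2[of "?x t - ?y" "rot90 \<theta>"] d r(3) by simp
    then have 2: "t \<in> ?J" using r(2)[of s t] by (auto simp: inner_diff_left abs_le_iff)
    have "norm (?x t) \<le> 1" using cell_subset_cball[OF assms(2-4)] True by auto
    then have "\<bar>t\<bar> \<le> 1"
      using Cauchy_Schwarz_ineq2[of "?x t" "rot90 \<theta>"] r(2)[of s t] r(3) by simp
    then have "\<bar>\<mu> * t\<bar> \<le> \<bar>\<mu>\<bar>" by (simp add: abs_mult mult_left_le)
    then have "exp (\<mu> * t) \<le> exp \<bar>\<mu>\<bar>" by simp
    then have "exp (\<mu> * t) * bump m h k (?x t) \<le> exp \<bar>\<mu>\<bar> * 1"
      by (intro mult_mono bump_le_1 bump_nonneg) auto
    then show ?thesis using 1 2 by (simp add: bump_nonneg)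
  qed
  have "\<bar>exp_radon \<mu> (bump m h k) (\<theta>, s)\<bar> \<le> (LINT t|lborel. \<bar>exp (\<mu> * t) * bump m h k (?x t)\<bar>)"
    unfolding exp_radon_unit[OF assms(5)] by (rule integral_abs_bound)
  also have "\<dots> \<le> (LINT t|lborel. exp \<bar>\<mu>\<bar> * indicator ?I s * indicator ?J t)"
    using int pt by (intro integral_mono integrable_mult_right integrable_real_indicator) (auto simp: emeasure_lborel_Icc_eq)
  also have "\<dots> = exp \<bar>\<mu>\<bar> * indicator ?I s * (4 * h)"
    using assms(2) by simp
  finally show ?thesis by (simp add: ac_simps)
qed

text \<open>128 pi is 16 * 4 * 2 pi: the squared height (4 h)^2, the strip of length 4 h, and the
  circle.\<close>

lemma exp_radon_bump_sq:
  assumes "m > 0" "h > 0" "real K * h \<le> 1 / 2" "k \<in> {..<K} \<times> {..<K}"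
  shows "(\<integral>\<^sup>+z. ennreal ((exp_radon \<mu> (bump m h k) z)\<^sup>2) \<partial>Z_measure) \<le> ennreal (128 * pi * exp (2 * \<bar>\<mu>\<bar>) * h ^ 3)"
proof -
  let ?T = "exp_radon \<mu> (bump m h k)"
  let ?c = "(exp \<bar>\<mu>\<bar> * (4 * h))\<^sup>2"
  have [measurable]: "?T \<in> borel_measurable Z_measure"
    by (intro exp_radon_measurable borel_measurable_continuous_onI continuous_bump)
  have "(\<integral>\<^sup>+z. ennreal ((?T z)\<^sup>2) \<partial>Z_measure)
    = (\<integral>\<^sup>+ \<phi> \<in> {0..<2*pi}. (\<integral>\<^sup>+ s \<in> {-1..1}. ennreal ((?T (vector [cos \<phi>, sin \<phi>], s))\<^sup>2) \<partial>lborel) \<partial>lborel)"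
    by (rule nn_integral_Z_measure) measurable
  also have "\<dots> \<le> (\<integral>\<^sup>+ \<phi> \<in> {0..<2*pi}. ennreal (?c * (4 * h)) \<partial>lborel)"
  proof (intro nn_integral_mono mult_right_mono)
    fix \<phi> :: real
    let ?\<theta> = "vector [cos \<phi>, sin \<phi>] :: real^2"
    let ?y = "vector [real (fst k) * h, real (snd k) * h] \<bullet> ?\<theta>"
    let ?I = "{?y - 2 * h..?y + 2 * h}"
    have \<theta>: "norm ?\<theta> = 1" by (simp add: norm_vec_def L2_set_def sum_2)
    have "(?T (?\<theta>, s))\<^sup>2 \<le> ?c * indicator ?I s" for s
    proof -
      have "\<bar>?T (?\<theta>, s)\<bar> \<le> exp \<bar>\<mu>\<bar> * (4 * h) * indicator ?I s"
        using exp_radon_bump_bound[OF assms \<theta>, of \<mu> s]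
        by (auto simp: indicator_def abs_le_iff split: if_splits)
      then have "\<bar>?T (?\<theta>, s)\<bar>\<^sup>2 \<le> (exp \<bar>\<mu>\<bar> * (4 * h) * indicator ?I s)\<^sup>2"
        by (rule power_mono) simp
      then show ?thesis by (cases "s \<in> ?I") (simp_all add: power_mult_distrib)
    qed
    note pt = this
    have "(\<integral>\<^sup>+ s \<in> {-1..1}. ennreal ((?T (?\<theta>, s))\<^sup>2) \<partial>lborel)
      \<le> (\<integral>\<^sup>+ s. ennreal ?c * indicator ?I s \<partial>lborel)"
    proof (rule nn_integral_mono)
      fix s
      have "ennreal ((?T (?\<theta>, s))\<^sup>2) * indicator {-1..1} s \<le> ennreal ((?T (?\<theta>, s))\<^sup>2) * 1"
        by (intro mult_left_mono) (auto simp: indicator_def)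
      also have "\<dots> \<le> ennreal (?c * indicator ?I s)"
        using pt[of s] by (simp only: mult_1_right ennreal_leI)
      also have "\<dots> = ennreal ?c * indicator ?I s"
        by (cases "s \<in> ?I") auto
      finally show "ennreal ((?T (?\<theta>, s))\<^sup>2) * indicator {-1..1} s \<le> ennreal ?c * indicator ?I s" .
    qed
    also have "\<dots> = ennreal (?c * (4 * h))"
      using assms(2) by (subst nn_integral_cmult_indicator) (auto simp: ennreal_mult'[symmetric])
    finally show "(\<integral>\<^sup>+ s \<in> {-1..1}. ennreal ((?T (?\<theta>, s))\<^sup>2) \<partial>lborel) \<le> ennreal (?c * (4 * h))" .
  qed simp
  also have "\<dots> = ennreal (?c * (4 * h) * (2 * pi))"
    by (subst nn_integral_cmult_indicator) (use assms(2) in \<open>auto simp: ennreal_mult'[symmetric]\<close>)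
  also have "?c * (4 * h) * (2 * pi) = 128 * pi * exp (2 * \<bar>\<mu>\<bar>) * h ^ 3"
    by (simp add: power_mult_distrib exp_double power2_eq_square power3_eq_cube)
  finally show ?thesis .
qed

lemma exp_radon_bump_sum_insert:
  assumes "m > 0" "h > 0" "real K * h \<le> 1 / 2" "insert k S \<subseteq> {..<K} \<times> {..<K}" "k \<notin> S" "norm \<theta> = 1"
  shows "exp_radon \<mu> (bump_sum m h a (insert k S)) (\<theta>, s)
    = exp_radon \<mu> (bump_sum m h a S) (\<theta>, s) + a * exp_radon \<mu> (bump m h k) (\<theta>, s)"
proof -
  have fin: "finite S" by (rule finite_subset[of _ "{..<K} \<times> {..<K}"]) (use assms in auto)
  have supp: "bump m h l x = 0" if "x \<notin> cball 0 1" "l \<in> insert k S" for x l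
    using that assms(4) by (intro bump_eq_0_outside_cball[OF assms(1-3)]) auto
  have 1: "integrable lborel (\<lambda>t. exp (\<mu> * t) * bump_sum m h a S (s *\<^sub>R \<theta> + t *\<^sub>R rot90 \<theta>))"
    by (rule exp_radon_integrable[OF continuous_bump_sum _ assms(6)]) (simp add: bump_sum_def supp)
  have 2: "integrable lborel (\<lambda>t. exp (\<mu> * t) * bump m h k (s *\<^sub>R \<theta> + t *\<^sub>R rot90 \<theta>))"
    by (rule exp_radon_integrable[OF continuous_bump _ assms(6)]) (simp add: supp)
  have "exp (\<mu> * t) * bump_sum m h a (insert k S) x
    = exp (\<mu> * t) * bump_sum m h a S x + a * (exp (\<mu> * t) * bump m h k x)" for t x
    using fin assms(5) by (simp add: bump_sum_def algebra_simps)
  then show ?thesis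
    unfolding exp_radon_unit[OF assms(6)] using 1 2 by simp
qed

lemma bump_sum_sobolev:
  assumes "m > 0" "real m \<ge> \<beta> + 1" "\<beta> \<ge> 0" "L > 0"
  shows "\<exists>c0>0. \<forall>h K S c. 0 < h \<longrightarrow> h \<le> 1 \<longrightarrow> real K * h \<le> 1 / 2 \<longrightarrow> S \<subseteq> {..<K} \<times> {..<K} \<longrightarrow> 0 \<le> c \<longrightarrow> c \<le> c0 \<longrightarrow>
    bump_sum m h (c * h powr \<beta>) S \<in> sobolev_class \<beta> L"
proof -
  obtain C where C: "C \<ge> 0" and E: "\<And>h a K S. 0 < h \<Longrightarrow> h \<le> 1 \<Longrightarrow> S \<subseteq> {..<K} \<times> {..<K} \<Longrightarrow>
    (\<integral>\<^sup>+ \<xi>. ennreal ((1 + (norm \<xi>)\<^sup>2) powr \<beta> * (cmod (fourier_transform (bump_sum m h a S) \<xi>))\<^sup>2) \<partial>lborel)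
      \<le> ennreal (C * (a\<^sup>2 * h powr (- 2 * \<beta>) * (h * real K)\<^sup>2))"
    using bump_sum_sobolev_energy[OF assms(1-3)] by blast
  \<comment> \<open>Solves (C + 1) * c0^2 = L; the + 1 covers C = 0.\<close>
  define c0 where "c0 = sqrt (L / (C + 1))"
  have "bump_sum m h (c * h powr \<beta>) S \<in> sobolev_class \<beta> L"
    if h: "0 < h" "h \<le> 1" "real K * h \<le> 1 / 2" and S: "S \<subseteq> {..<K} \<times> {..<K}" and c: "0 \<le> c" "c \<le> c0" for h K S c
  proof -
    have "(h powr \<beta>)\<^sup>2 = h powr (2 * \<beta>)"
      using h by (simp add: powr_power mult.commute)
    then have "(c * h powr \<beta>)\<^sup>2 * h powr (- 2 * \<beta>) = c\<^sup>2"
      using h by (simp add: power_mult_distrib powr_add[symmetric] mult.assoc)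
    then have "C * ((c * h powr \<beta>)\<^sup>2 * h powr (- 2 * \<beta>) * (h * real K)\<^sup>2) = C * (c\<^sup>2 * (h * real K)\<^sup>2)"
      by simp
    also have "\<dots> \<le> (C + 1) * (c0\<^sup>2 * 1)"
      using C c h power_mono[of "h * real K" 1 2]
      by (intro mult_mono power_mono) (auto simp: mult.commute)
    also have "\<dots> = L" using C assms(4) by (simp add: c0_def)
    finally have le: "C * ((c * h powr \<beta>)\<^sup>2 * h powr (- 2 * \<beta>) * (h * real K)\<^sup>2) \<le> L" .
    have "bump m h k x = 0" if "k \<in> S" "x \<notin> cball 0 1" for k x
      using that S by (intro bump_eq_0_outside_cball[OF assms(1) h(1,3)]) auto
    then have "bump_sum m h (c * h powr \<beta>) S x = 0" if "x \<notin> cball 0 1" for x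
      using that by (simp add: bump_sum_def)
    then show ?thesis
      unfolding sobolev_class_def
      using order_trans[OF E[OF h(1,2) S] ennreal_leI[OF le]] continuous_bump_sum by blast
  qed
  moreover have "c0 > 0" using C assms(4) by (simp add: c0_def)
  ultimately show ?thesis by blast
qed

section \<open>Squared L^2 norm of a bump\<close>

lemma nn_integral_bump_sq:
  assumes "m > 0" "h > 0"
  shows "(\<integral>\<^sup>+x. ennreal ((bump m h k x)\<^sup>2) \<partial>lborel)
    = ennreal (h\<^sup>2) * (\<integral>\<^sup>+t. ennreal ((bump1 m t)\<^sup>2) \<partial>lborel)\<^sup>2"
proof -
  let ?J = "\<integral>\<^sup>+t. ennreal ((bump1 m t)\<^sup>2) \<partial>lborel"
  have sc: "(\<integral>\<^sup>+t. ennreal ((bump1 m (t / h - j))\<^sup>2) \<partial>lborel) = ennreal h * ?J" for j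
    using assms by (subst nn_integral_real_affine[of _ h "h * j"]) (auto simp: field_simps)
  have [measurable]: "bump m h k \<in> borel_measurable borel"
    by (intro borel_measurable_continuous_onI continuous_bump)
  have "(\<integral>\<^sup>+x. ennreal ((bump m h k x)\<^sup>2) \<partial>lborel)
    = (\<integral>\<^sup>+a. \<integral>\<^sup>+b. ennreal ((bump1 m (a / h - real (fst k)))\<^sup>2) * ennreal ((bump1 m (b / h - real (snd k)))\<^sup>2) \<partial>lborel \<partial>lborel)"
    by (subst nn_integral_real2) (auto simp: bump_def power_mult_distrib ennreal_mult')
  also have "\<dots> = (ennreal h * ?J) * (ennreal h * ?J)"
    by (simp add: nn_integral_cmult nn_integral_multc sc)
  also have "\<dots> = ennreal (h\<^sup>2) * ?J\<^sup>2"
    using assms by (simp add: power2_eq_square ennreal_mult' ac_simps)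
  finally show ?thesis .
qed

lemma nn_integral_bump1_sq:
  assumes "m > 0"
  shows "\<exists>J>0. (\<integral>\<^sup>+t. ennreal ((bump1 m t)\<^sup>2) \<partial>lborel) = ennreal J"
proof -
  let ?J = "\<integral>\<^sup>+t. ennreal ((bump1 m t)\<^sup>2) \<partial>lborel"
  have "?J \<le> (\<integral>\<^sup>+t. indicator {0..1} t \<partial>(lborel :: real measure))"
  proof (rule nn_integral_mono)
    fix t
    have "(bump1 m t)\<^sup>2 \<le> 1" by (intro power_le_one bump1_nonneg bump1_le_1)
    then show "ennreal ((bump1 m t)\<^sup>2) \<le> indicator {0..1} t"
      using bump1_eq_0[OF assms, of t] by (auto simp: indicator_def ennreal_le_1)
  qed
  then have fin: "?J < \<infinity>" by (auto simp: less_top[symmetric] top_unique)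
  have "?J \<noteq> 0"
  proof
    assume "?J = 0"
    then have "AE t in lborel. ennreal ((bump1 m t)\<^sup>2) = 0"
      by (subst (asm) nn_integral_0_iff_AE) auto
    then have "AE t in lborel. t \<notin> {0<..<1::real}"
      by eventually_elim (use bump1_pos[of _ m] in fastforce)
    then have "emeasure lborel {0<..<1::real} = 0"
      by (subst (asm) AE_iff_measurable[of "{0<..<1::real}"]) auto
    then show False by simp
  qed
  moreover from fin obtain r where "?J = ennreal r" "r \<ge> 0" by (cases ?J) auto
  ultimately show ?thesis by (intro exI[of _ r]) (auto simp: less_le)
qed

section \<open>Lower bound for the minimax risk\<close>

text \<open>Independence makes the joint law a product, so that the errors can be integrated out for
  a frozen design.\<close>

lemma nn_integral_indep_rv:
  assumes "prob_space M" and "indep_rv M S X T Y" and [measurable]: "H \<in> borel_measurable (S \<Otimes>\<^sub>M T)"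
  shows "(\<integral>\<^sup>+\<omega>. H (X \<omega>, Y \<omega>) \<partial>M) = (\<integral>\<^sup>+x. \<integral>\<^sup>+y. H (x, y) \<partial>distr M T Y \<partial>distr M S X)"
proof -
  interpret prob_space M by fact
  have X[measurable]: "X \<in> measurable M S" and Y[measurable]: "Y \<in> measurable M T"
    and ind: "indep_set {X -` A \<inter> space M | A. A \<in> sets S} {Y -` B \<inter> space M | B. B \<in> sets T}"
    using assms(2) by (auto simp: indep_rv_def)
  interpret DX: prob_space "distr M S X" by (rule prob_space_distr) fact
  interpret DY: prob_space "distr M T Y" by (rule prob_space_distr) fact
  have eq: "distr M S X \<Otimes>\<^sub>M distr M T Y = distr M (S \<Otimes>\<^sub>M T) (\<lambda>\<omega>. (X \<omega>, Y \<omega>))"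
  proof (rule pair_measure_eqI)
    fix A B assume A: "A \<in> sets (distr M S X)" and B: "B \<in> sets (distr M T Y)"
    then have A': "X -` A \<inter> space M \<in> sets M" and B': "Y -` B \<inter> space M \<in> sets M"
      using measurable_sets[OF X] measurable_sets[OF Y] by auto
    have "emeasure (distr M (S \<Otimes>\<^sub>M T) (\<lambda>\<omega>. (X \<omega>, Y \<omega>))) (A \<times> B)
        = emeasure M ((X -` A \<inter> space M) \<inter> (Y -` B \<inter> space M))"
      using A B by (subst emeasure_distr) (auto intro!: arg_cong[of _ _ "emeasure M"])
    also have "\<dots> = emeasure M (X -` A \<inter> space M) * emeasure M (Y -` B \<inter> space M)"
    proof -
      have "prob ((X -` A \<inter> space M) \<inter> (Y -` B \<inter> space M)) = prob (X -` A \<inter> space M) * prob (Y -` B \<inter> space M)"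
        using A B by (intro indep_setD[OF ind]) auto
      then show ?thesis by (simp add: emeasure_eq_measure ennreal_mult')
    qed
    finally show "emeasure (distr M S X) A * emeasure (distr M T Y) B
        = emeasure (distr M (S \<Otimes>\<^sub>M T) (\<lambda>\<omega>. (X \<omega>, Y \<omega>))) (A \<times> B)"
      using A B by (simp add: emeasure_distr)
  qed (simp_all add: DX.sigma_finite_measure_axioms DY.sigma_finite_measure_axioms cong: sets_pair_measure_cong)
  have "(\<integral>\<^sup>+\<omega>. H (X \<omega>, Y \<omega>) \<partial>M) = (\<integral>\<^sup>+z. H z \<partial>distr M (S \<Otimes>\<^sub>M T) (\<lambda>\<omega>. (X \<omega>, Y \<omega>)))"
    by (subst nn_integral_distr) auto
  also have "\<dots> = (\<integral>\<^sup>+z. H z \<partial>(distr M S X \<Otimes>\<^sub>M distr M T Y))"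
    by (simp add: eq)
  also have "\<dots> = (\<integral>\<^sup>+x. \<integral>\<^sup>+y. H (x, y) \<partial>distr M T Y \<partial>distr M S X)"
  proof (rule DY.nn_integral_fst[symmetric])
    have "sets (distr M S X \<Otimes>\<^sub>M distr M T Y) = sets (S \<Otimes>\<^sub>M T)"
      by (intro sets_pair_measure_cong) auto
    then show "H \<in> borel_measurable (distr M S X \<Otimes>\<^sub>M distr M T Y)"
      using assms(3) measurable_cong_sets by blast
  qed
  finally show ?thesis .
qed

text \<open>For a frozen design, replacing one regression function by another shifts each error by
  its own amount. The shifted law is again a product, so the product bound for likelihood ratios
  applies.\<close>

lemma PiM_translate:
  fixes G :: "real measure" and d :: "'i \<Rightarrow> real"
  assumes "finite I" "real_distribution G"
  shows "distr (PiM I (\<lambda>_. G)) (PiM I (\<lambda>_. borel)) (\<lambda>e. \<lambda>i\<in>I. e i - d i)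
    = PiM I (\<lambda>i. distr G borel (\<lambda>u. u - d i))"
proof -
  interpret G: real_distribution G by fact
  interpret P: product_prob_space "\<lambda>_::'i. G" by (intro product_prob_spaceI G.prob_space_axioms)
  interpret Q: product_prob_space "\<lambda>i. distr G borel (\<lambda>u. u - d i)"
    by (intro product_prob_spaceI G.prob_space_distr) auto
  let ?s = "\<lambda>e. \<lambda>i\<in>I. e i - d i"
  have m: "?s \<in> measurable (PiM I (\<lambda>_. G)) (PiM I (\<lambda>_. borel))"
    by (intro measurable_restrict borel_measurable_diff) (auto intro!: measurable_component_singleton)
  show ?thesis
  proof (rule Q.PiM_eqI)
    show "sets (distr (PiM I (\<lambda>_. G)) (PiM I (\<lambda>_. borel)) ?s) = sets (PiM I (\<lambda>i. distr G borel (\<lambda>u. u - d i)))"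
      by (simp cong: sets_PiM_cong)
    fix A assume "\<And>i. i \<in> I \<Longrightarrow> A i \<in> sets (distr G borel (\<lambda>u. u - d i))"
    then have A: "A i \<in> sets borel" if "i \<in> I" for i using that by auto
    have A': "(\<lambda>u. u - d i) -` A i \<in> sets borel" if "i \<in> I" for i
      using measurable_sets[of "\<lambda>u. u - d i" borel borel, OF _ A[OF that]] by simp
    have "?s -` (Pi\<^sub>E I A) \<inter> space (PiM I (\<lambda>_. G)) = Pi\<^sub>E I (\<lambda>i. (\<lambda>u. u - d i) -` A i)"
      by (auto simp: space_PiM PiE_iff)
    then have "emeasure (distr (PiM I (\<lambda>_. G)) (PiM I (\<lambda>_. borel)) ?s) (Pi\<^sub>E I A)
        = emeasure (PiM I (\<lambda>_. G)) (Pi\<^sub>E I (\<lambda>i. (\<lambda>u. u - d i) -` A i))"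
      using A \<open>finite I\<close> by (subst emeasure_distr[OF m]) (auto intro!: sets_PiM_I_finite)
    also have "\<dots> = (\<Prod>i\<in>I. emeasure G ((\<lambda>u. u - d i) -` A i))"
      using A' \<open>finite I\<close> by (intro P.emeasure_PiM) auto
    also have "\<dots> = (\<Prod>i\<in>I. emeasure (distr G borel (\<lambda>u. u - d i)) (A i))"
      using A by (intro prod.cong) (auto simp: emeasure_distr)
    finally show "emeasure (distr (PiM I (\<lambda>_. G)) (PiM I (\<lambda>_. borel)) ?s) (Pi\<^sub>E I A)
        = (\<Prod>i\<in>I. emeasure (distr G borel (\<lambda>u. u - d i)) (A i))" .
  qed fact
qed

text \<open>For a frozen design x the two data laws differ by the shifts D (x i) of the errors, so
  their Kullback distance is at most the sum of I0 * D (x i)^2. The two-point bound is exponential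
  in this sum; Jensen's inequality replaces the random sum by its mean m.\<close>

lemma data_law_two_point:
  fixes f g :: "real^2 \<Rightarrow> real" and A B :: "(nat \<Rightarrow> ((real^2) \<times> real) \<times> real) \<Rightarrow> ennreal"
  assumes M: "prob_space M"
    and Xm: "\<And>i. i < n \<Longrightarrow> X i \<in> measurable M Z_measure"
    and \<epsilon>m: "\<And>i. i < n \<Longrightarrow> \<epsilon> i \<in> borel_measurable M"
    and ind: "indep_rv M
              (PiM {..<n} (\<lambda>_. Z_measure)) (\<lambda>\<omega>. \<lambda>i\<in>{..<n}. X i \<omega>)
              (PiM {..<n} (\<lambda>_. borel)) (\<lambda>\<omega>. \<lambda>i\<in>{..<n}. \<epsilon> i \<omega>)"
    and err: "distr M (PiM {..<n} (\<lambda>_. borel)) (\<lambda>\<omega>. \<lambda>i\<in>{..<n}. \<epsilon> i \<omega>) = PiM {..<n} (\<lambda>_. G)"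
    and G: "real_distribution G"
    and kl: "\<And>v. \<bar>v\<bar> \<le> v0 \<Longrightarrow> kullback G (distr G borel (\<lambda>u. u - v)) \<le> ereal (I0 * v\<^sup>2)" and "I0 \<ge> 0"
    and f: "f \<in> borel_measurable borel" and g: "g \<in> borel_measurable borel"
    and v: "\<And>z. z \<in> space Z_measure \<Longrightarrow> \<bar>exp_radon \<mu> f z - exp_radon \<mu> g z\<bar> \<le> v0"
    and m: "(\<integral>\<^sup>+\<omega>. (\<Sum>i<n. ennreal (I0 * (exp_radon \<mu> f (X i \<omega>) - exp_radon \<mu> g (X i \<omega>))\<^sup>2)) \<partial>M) \<le> ennreal m" "m \<ge> 0"
    and A[measurable]: "A \<in> borel_measurable (data_space n)" and B[measurable]: "B \<in> borel_measurable (data_space n)"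
    and AB: "\<And>d. d \<in> space (data_space n) \<Longrightarrow> ennreal \<delta> \<le> A d + B d" and "\<delta> \<ge> 0"
  shows "ennreal (\<delta> * exp (- (m + 1))) \<le>
    (\<integral>\<^sup>+d. A d \<partial>data_law \<mu> M n X \<epsilon> f) + (\<integral>\<^sup>+d. B d \<partial>data_law \<mu> M n X \<epsilon> g)"
proof -
  interpret prob_space M by fact
  interpret G: real_distribution G by fact
  let ?I = "{..<n}"
  let ?ZX = "PiM ?I (\<lambda>_. Z_measure)" and ?E = "PiM ?I (\<lambda>_. borel :: real measure)" and ?G = "PiM ?I (\<lambda>_. G)"
  let ?X = "\<lambda>\<omega>. \<lambda>i\<in>?I. X i \<omega>" and ?e = "\<lambda>\<omega>. \<lambda>i\<in>?I. \<epsilon> i \<omega>"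
  let ?T = "exp_radon \<mu>"
  \<comment> \<open>The data as a function of design and errors separately, so that the design can
    be frozen.\<close>
  define \<Phi> where "\<Phi> q x e = (\<lambda>i\<in>?I. (x i, ?T q (x i) + e i))" for q :: "real^2 \<Rightarrow> real" and x e
  define D where "D z = ?T f z - ?T g z" for z
  have Tm[measurable]: "?T f \<in> borel_measurable Z_measure" "?T g \<in> borel_measurable Z_measure"
    using f g by (auto intro: exp_radon_measurable)
  have Dm[measurable]: "D \<in> borel_measurable Z_measure" unfolding D_def by measurable
  have setsG: "sets ?G = sets ?E" by (intro sets_PiM_cong) auto
  have Xv[measurable]: "?X \<in> measurable M ?ZX" using Xm by (intro measurable_restrict) auto
  have ev[measurable]: "?e \<in> measurable M ?E" using \<epsilon>m by (intro measurable_restrict) auto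
  have \<Phi>m: "(\<lambda>z. \<Phi> q (fst z) (snd z)) \<in> measurable (?ZX \<Otimes>\<^sub>M ?E) (data_space n)"
    if [measurable]: "?T q \<in> borel_measurable Z_measure" for q
    unfolding \<Phi>_def by (intro measurable_restrict) measurable
  have law: "(\<integral>\<^sup>+d. C d \<partial>data_law \<mu> M n X \<epsilon> q) = (\<integral>\<^sup>+x. \<integral>\<^sup>+e. C (\<Phi> q x e) \<partial>?G \<partial>distr M ?ZX ?X)"
    if q: "?T q \<in> borel_measurable Z_measure" and C: "C \<in> borel_measurable (data_space n)" for q C
  proof -
    have \<Phi>X: "(\<lambda>i\<in>?I. (X i \<omega>, ?T q (X i \<omega>) + \<epsilon> i \<omega>)) = \<Phi> q (?X \<omega>) (?e \<omega>)" for \<omega>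
      by (auto simp: \<Phi>_def fun_eq_iff restrict_def)
    have m1: "(\<lambda>\<omega>. \<Phi> q (?X \<omega>) (?e \<omega>)) \<in> measurable M (data_space n)"
      using measurable_compose[OF measurable_Pair[OF Xv ev] \<Phi>m[OF q]] by simp
    have "(\<integral>\<^sup>+d. C d \<partial>data_law \<mu> M n X \<epsilon> q) = (\<integral>\<^sup>+\<omega>. C (\<Phi> q (?X \<omega>) (?e \<omega>)) \<partial>M)"
      unfolding data_law_def \<Phi>X by (subst nn_integral_distr[OF m1]) (use C in auto)
    also have "\<dots> = (\<integral>\<^sup>+\<omega>. (\<lambda>z. C (\<Phi> q (fst z) (snd z))) (?X \<omega>, ?e \<omega>) \<partial>M)"
      by simp
    also have "\<dots> = (\<integral>\<^sup>+x. \<integral>\<^sup>+e. C (\<Phi> q x e) \<partial>?G \<partial>distr M ?ZX ?X)"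
      by (subst nn_integral_indep_rv[OF M ind measurable_compose[OF \<Phi>m[OF q] C]]) (simp add: err)
    finally show ?thesis .
  qed
  have fixed_design: "ennreal (\<delta> * exp (- ((\<Sum>i<n. I0 * (D (x i))\<^sup>2) + 1)))
      \<le> (\<integral>\<^sup>+e. A (\<Phi> f x e) \<partial>?G) + (\<integral>\<^sup>+e. B (\<Phi> g x e) \<partial>?G)" if x: "x \<in> space ?ZX" for x
  proof -
    let ?Q = "\<lambda>i. distr G borel (\<lambda>u. u - D (x i))"
    have xi: "x i \<in> space Z_measure" if "i < n" for i
      using x that by (auto simp: space_PiM)
    have \<Phi>x: "\<Phi> f x \<in> measurable ?E (data_space n)"
      using measurable_compose[OF measurable_Pair1'[OF x] \<Phi>m[OF Tm(1)]] by simp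
    then have \<Phi>x': "\<Phi> f x \<in> measurable ?G (data_space n)"
      using setsG measurable_cong_sets by blast
    have "\<exists>l. lr_dominated G (?Q i) (I0 * (D (x i))\<^sup>2) l" if "i < n" for i
      using v[OF xi[OF that]] unfolding D_def
      by (intro kullback_imp_lr_dominated kl G.prob_space_axioms G.prob_space_distr) auto
    then obtain l where l: "\<And>i. i \<in> ?I \<Longrightarrow> lr_dominated G (?Q i) (I0 * (D (x i))\<^sup>2) (l i)"
      unfolding lessThan_iff by metis
    have dom: "lr_dominated ?G (PiM ?I ?Q) (\<Sum>i<n. I0 * (D (x i))\<^sup>2) (\<lambda>y. \<Sum>i<n. l i (y i))"
      by (rule lr_dominated_PiM) (auto intro!: l G.prob_space_axioms G.prob_space_distr)
    have shift: "PiM ?I ?Q = distr ?G ?E (\<lambda>e. \<lambda>i\<in>?I. e i - D (x i))"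
      by (rule PiM_translate[OF _ G, symmetric]) simp
    have sm: "(\<lambda>e. \<lambda>i\<in>?I. e i - D (x i)) \<in> measurable ?G ?E"
      by (intro measurable_restrict borel_measurable_diff) (auto intro!: measurable_component_singleton)
    \<comment> \<open>Data produced by g with errors e are data produced by f with errors e - D.
      Both hypotheses thus become two error laws seen through the same map
      \<open>\<Phi> f x\<close>.\<close>
    have eq: "\<Phi> f x (\<lambda>i\<in>?I. e i - D (x i)) = \<Phi> g x e" for e
      by (auto simp: \<Phi>_def D_def fun_eq_iff)
    have "(\<integral>\<^sup>+e. B (\<Phi> f x e) \<partial>PiM ?I ?Q) = (\<integral>\<^sup>+e. B (\<Phi> g x e) \<partial>?G)"
      unfolding shift by (subst nn_integral_distr[OF sm]) (use measurable_compose[OF \<Phi>x B] in \<open>auto simp: eq\<close>)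
    moreover have "ennreal (\<delta> * exp (- ((\<Sum>i<n. I0 * (D (x i))\<^sup>2) + 1)))
      \<le> (\<integral>\<^sup>+e. A (\<Phi> f x e) \<partial>?G) + (\<integral>\<^sup>+e. B (\<Phi> f x e) \<partial>PiM ?I ?Q)"
    proof (rule lr_dominated_two_point[OF _ _ dom])
      show "prob_space ?G" by (intro prob_space_PiM G.prob_space_axioms)
      show "prob_space (PiM ?I ?Q)" by (intro prob_space_PiM G.prob_space_distr) auto
      show "(\<lambda>e. A (\<Phi> f x e)) \<in> borel_measurable ?G" "(\<lambda>e. B (\<Phi> f x e)) \<in> borel_measurable ?G"
        by (rule measurable_compose[OF \<Phi>x'], fact)+
      show "ennreal \<delta> \<le> A (\<Phi> f x e) + B (\<Phi> f x e)" if "e \<in> space ?G" for e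
        using AB measurable_space[OF \<Phi>x' that] by auto
    qed fact
    ultimately show ?thesis by simp
  qed
  \<comment> \<open>The exponent of the bound for the realized design, including the + 1 of the
    two-point bound; its mean is at most m + 1.\<close>
  define \<kappa> where "\<kappa> \<omega> = (\<Sum>i<n. I0 * (D (X i \<omega>))\<^sup>2) + 1" for \<omega>
  have \<kappa>0: "\<kappa> \<omega> \<ge> 0" for \<omega> unfolding \<kappa>_def using \<open>I0 \<ge> 0\<close> by (simp add: sum_nonneg)
  have D': "(\<lambda>\<omega>. D (X i \<omega>)) \<in> borel_measurable M" if "i < n" for i
    by (rule measurable_compose[OF Xm[OF that] Dm])
  have \<kappa>m: "\<kappa> \<in> borel_measurable M"
    unfolding \<kappa>_def by (intro borel_measurable_add borel_measurable_sum borel_measurable_times borel_measurable_power D') auto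
  have "(\<integral>\<^sup>+\<omega>. ennreal (\<kappa> \<omega>) \<partial>M) = (\<integral>\<^sup>+\<omega>. (\<Sum>i<n. ennreal (I0 * (D (X i \<omega>))\<^sup>2)) + 1 \<partial>M)"
    unfolding \<kappa>_def using \<open>I0 \<ge> 0\<close> by (intro nn_integral_cong) (simp add: sum_nonneg)
  also have "\<dots> = (\<integral>\<^sup>+\<omega>. (\<Sum>i<n. ennreal (I0 * (D (X i \<omega>))\<^sup>2)) \<partial>M) + 1"
    by (subst nn_integral_add) (auto intro!: borel_measurable_sum measurable_compose[OF _ measurable_ennreal] borel_measurable_times borel_measurable_power D' simp: emeasure_space_1)
  also have "\<dots> \<le> ennreal (m + 1)"
    using m by (simp add: D_def add_right_mono)
  finally have "ennreal (exp (- (m + 1))) \<le> (\<integral>\<^sup>+\<omega>. ennreal (exp (- \<kappa> \<omega>)) \<partial>M)"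
    using \<kappa>0 m(2) by (intro exp_neg_nn_integral_ge[OF M \<kappa>m]) auto
  then have "ennreal (\<delta> * exp (- (m + 1))) \<le> ennreal \<delta> * (\<integral>\<^sup>+\<omega>. ennreal (exp (- \<kappa> \<omega>)) \<partial>M)"
    using \<open>\<delta> \<ge> 0\<close> by (simp add: ennreal_mult' mult_left_mono)
  also have "\<dots> = (\<integral>\<^sup>+\<omega>. ennreal (\<delta> * exp (- \<kappa> \<omega>)) \<partial>M)"
    using \<kappa>m \<open>\<delta> \<ge> 0\<close> by (subst nn_integral_cmult[symmetric]) (auto simp: ennreal_mult')
  also have "\<dots> = (\<integral>\<^sup>+x. ennreal (\<delta> * exp (- ((\<Sum>i<n. I0 * (D (x i))\<^sup>2) + 1))) \<partial>distr M ?ZX ?X)"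
    by (subst nn_integral_distr[OF Xv]) (measurable, simp add: \<kappa>_def)
  also have "\<dots> \<le> (\<integral>\<^sup>+x. (\<integral>\<^sup>+e. A (\<Phi> f x e) \<partial>?G) + (\<integral>\<^sup>+e. B (\<Phi> g x e) \<partial>?G) \<partial>distr M ?ZX ?X)"
    by (intro nn_integral_mono fixed_design) auto
  also have "\<dots> = (\<integral>\<^sup>+x. \<integral>\<^sup>+e. A (\<Phi> f x e) \<partial>?G \<partial>distr M ?ZX ?X) + (\<integral>\<^sup>+x. \<integral>\<^sup>+e. B (\<Phi> g x e) \<partial>?G \<partial>distr M ?ZX ?X)"
  proof (rule nn_integral_add)
    have pG: "prob_space ?G" by (intro prob_space_PiM G.prob_space_axioms)
    then have sG: "sigma_finite_measure ?G"
      by (simp add: prob_space_imp_sigma_finite)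
    have ZG: "sets (distr M ?ZX ?X \<Otimes>\<^sub>M ?G) = sets (?ZX \<Otimes>\<^sub>M ?E)"
      by (intro sets_pair_measure_cong) (auto simp: setsG)
    have "(\<lambda>x. \<integral>\<^sup>+e. C (\<Phi> q x e) \<partial>?G) \<in> borel_measurable (distr M ?ZX ?X)"
      if q: "?T q \<in> borel_measurable Z_measure" and C: "C \<in> borel_measurable (data_space n)" for q C
    proof (rule sigma_finite_measure.borel_measurable_nn_integral[OF sG])
      have "(\<lambda>z. C (\<Phi> q (fst z) (snd z))) \<in> borel_measurable (distr M ?ZX ?X \<Otimes>\<^sub>M ?G)"
        using measurable_compose[OF \<Phi>m[OF q] C] ZG measurable_cong_sets by blast
      then show "(\<lambda>(x, e). C (\<Phi> q x e)) \<in> borel_measurable (distr M ?ZX ?X \<Otimes>\<^sub>M ?G)"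
        by (simp add: case_prod_unfold)
    qed
    then show "(\<lambda>x. \<integral>\<^sup>+e. A (\<Phi> f x e) \<partial>?G) \<in> borel_measurable (distr M ?ZX ?X)"
      "(\<lambda>x. \<integral>\<^sup>+e. B (\<Phi> g x e) \<partial>?G) \<in> borel_measurable (distr M ?ZX ?X)"
      using Tm A B by auto
  qed
  also have "\<dots> = (\<integral>\<^sup>+d. A d \<partial>data_law \<mu> M n X \<epsilon> f) + (\<integral>\<^sup>+d. B d \<partial>data_law \<mu> M n X \<epsilon> g)"
    by (simp add: law[OF Tm(1) A] law[OF Tm(2) B])
  finally show ?thesis .
qed

text \<open>R S k stands for the risk on cell k when the truth is S. For each k the subsets split
  into 2 ^ (card J - 1) pairs S, insert k S, each contributing at least rho. Summing over k and
  comparing with the total over all 2 ^ card J subsets leaves the factor 2.\<close>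

lemma assouad:
  fixes R :: "'k set \<Rightarrow> 'k \<Rightarrow> ennreal"
  assumes "finite J"
    and R: "\<And>k S. k \<in> J \<Longrightarrow> S \<subseteq> J - {k} \<Longrightarrow> \<rho> \<le> R S k + R (insert k S) k"
    and s: "\<And>S. S \<subseteq> J \<Longrightarrow> (\<Sum>k\<in>J. R S k) \<le> s"
  shows "of_nat (card J) * \<rho> \<le> 2 * s"
proof (cases "J = {}")
  case False
  let ?N = "card J"
  have pair: "2 ^ (?N - 1) * \<rho> \<le> (\<Sum>S\<in>Pow J. R S k)" if k: "k \<in> J" for k
  proof -
    have P: "Pow J = Pow (J - {k}) \<union> insert k ` Pow (J - {k})"
      using Pow_insert[of k "J - {k}"] k by (simp add: insert_absorb)
    have inj: "inj_on (insert k) (Pow (J - {k}))"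
      by (intro inj_onI) (metis Diff_iff PowD insert_ident singletonI subset_iff)
    have "(\<Sum>S\<in>Pow J. R S k) = (\<Sum>S\<in>Pow (J - {k}). R S k) + (\<Sum>S\<in>insert k ` Pow (J - {k}). R S k)"
      unfolding P using \<open>finite J\<close> by (intro sum.union_disjoint) auto
    also have "\<dots> = (\<Sum>S\<in>Pow (J - {k}). R S k + R (insert k S) k)"
      using inj by (simp add: sum.reindex sum.distrib)
    also have "\<dots> \<ge> (\<Sum>S\<in>Pow (J - {k}). \<rho>)"
      using R[OF k] by (intro sum_mono) auto
    also have "(\<Sum>S\<in>Pow (J - {k}). \<rho>) = 2 ^ (?N - 1) * \<rho>"
      using \<open>finite J\<close> k by (simp add: card_Pow)
    finally show ?thesis .
  qed
  have "2 ^ (?N - 1) * (of_nat ?N * \<rho>) = (\<Sum>k\<in>J. 2 ^ (?N - 1) * \<rho>)"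
    by (simp add: ac_simps)
  also have "\<dots> \<le> (\<Sum>k\<in>J. \<Sum>S\<in>Pow J. R S k)"
    by (intro sum_mono pair)
  also have "\<dots> = (\<Sum>S\<in>Pow J. \<Sum>k\<in>J. R S k)"
    by (rule sum.swap)
  also have "\<dots> \<le> (\<Sum>S\<in>Pow J. s)"
    by (intro sum_mono s) auto
  also have "\<dots> = 2 ^ (Suc (?N - 1)) * s"
    using False \<open>finite J\<close> by (simp add: card_Pow card_gt_0_iff)
  finally have "2 ^ (?N - 1) * (of_nat ?N * \<rho>) \<le> 2 ^ (?N - 1) * (2 * s)"
    by (simp add: ac_simps)
  then show ?thesis
    by (subst (asm) ennreal_mult_le_mult_iff) (auto simp: power_eq_top_ennreal)
qed simp


section \<open>Risk over the hypercube of bump sums\<close>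

lemma borel_measurable_cell [measurable]: "cell h k \<in> sets borel"
proof -
  have [measurable]: "(\<lambda>x::real^2. x $ i) \<in> borel_measurable borel" for i
    by (intro borel_measurable_continuous_onI continuous_intros)
  have "cell h k = {x \<in> space borel. real (fst k) * h < x $ 1 \<and> x $ 1 < (real (fst k) + 1) * h \<and>
                  real (snd k) * h < x $ 2 \<and> x $ 2 < (real (snd k) + 1) * h}"
    by (simp add: cell_def)
  also have "\<dots> \<in> sets borel" by measurable
  finally show ?thesis .
qed

text \<open>Assouad's lemma with the loss localized to cells. The parameter m0 bounds the mean
  Kullback distance between neighbours; as long as it stays bounded in n, each bump costs a fixed
  fraction of its squared norm.\<close>

lemma bump_sum_risk_lower_bound:
  fixes X :: "nat \<Rightarrow> 'w \<Rightarrow> (real^2) \<times> real"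
  assumes M: "prob_space M"
    and Xm: "\<And>i. i < n \<Longrightarrow> X i \<in> measurable M Z_measure"
    and \<epsilon>m: "\<And>i. i < n \<Longrightarrow> \<epsilon> i \<in> borel_measurable M"
    and ind: "indep_rv M
              (PiM {..<n} (\<lambda>_. Z_measure)) (\<lambda>\<omega>. \<lambda>i\<in>{..<n}. X i \<omega>)
              (PiM {..<n} (\<lambda>_. borel)) (\<lambda>\<omega>. \<lambda>i\<in>{..<n}. \<epsilon> i \<omega>)"
    and err: "distr M (PiM {..<n} (\<lambda>_. borel)) (\<lambda>\<omega>. \<lambda>i\<in>{..<n}. \<epsilon> i \<omega>) = PiM {..<n} (\<lambda>_. G)"
    and G: "real_distribution G"
    and kl: "\<And>v. \<bar>v\<bar> \<le> v0 \<Longrightarrow> kullback G (distr G borel (\<lambda>u. u - v)) \<le> ereal (I0 * v\<^sup>2)" and I0: "I0 \<ge> 0"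
    and design: "\<And>g. g \<in> borel_measurable Z_measure \<Longrightarrow>
      (\<integral>\<^sup>+ \<omega>. (\<Sum>i<n. g (X i \<omega>)) \<partial>M) \<le> ennreal C3 * of_nat n * (\<integral>\<^sup>+ z. g z \<partial>Z_measure)"
    and fh: "fh \<in> estimators n"
    and mh: "m > 0" "h > 0" "real K * h \<le> 1 / 2" and a: "a \<ge> 0"
    and av: "a * (exp \<bar>\<mu>\<bar> * (4 * h)) \<le> v0"
    and m0: "max 0 C3 * real n * (I0 * a\<^sup>2 * (128 * pi * exp (2 * \<bar>\<mu>\<bar>) * h ^ 3)) \<le> m0" "m0 \<ge> 0"
    and J: "(\<integral>\<^sup>+t. ennreal ((bump1 m t)\<^sup>2) \<partial>lborel) = ennreal J" "J \<ge> 0"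
    and F: "\<And>S. S \<subseteq> {..<K} \<times> {..<K} \<Longrightarrow> bump_sum m h a S \<in> F"
  shows "ennreal ((real K)\<^sup>2 * (a\<^sup>2 * h\<^sup>2 * J\<^sup>2 * exp (- (m0 + 1))) / 4)
    \<le> (SUP f\<in>F. MISE (data_law \<mu> M n X \<epsilon> f) fh f)"
proof -
  let ?J = "{..<K} \<times> {..<K}"
  let ?f = "bump_sum m h a"
  let ?T = "exp_radon \<mu>"
  let ?s = "SUP f\<in>F. MISE (data_law \<mu> M n X \<epsilon> f) fh f"
  \<comment> \<open>The squared L^2 norm of one bump of height a, halved by the parallelogram
    inequality below.\<close>
  let ?\<delta> = "a\<^sup>2 * h\<^sup>2 * J\<^sup>2 / 2"
  \<comment> \<open>The loss on a single cell: the cells are disjoint subsets of the unit ball, so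
    these losses add up to at most the full loss.\<close>
  define A where "A S k d = (\<integral>\<^sup>+x. ennreal (\<bar>fh x d - ?f S x\<bar>\<^sup>2) * indicator (cell h k) x \<partial>lborel)" for S k d
  define R where "R S k = (\<integral>\<^sup>+d. A S k d \<partial>data_law \<mu> M n X \<epsilon> (?f S))" for S k
  have fm[measurable]: "?f S \<in> borel_measurable borel" for S
    by (intro borel_measurable_continuous_onI continuous_bump_sum)
  have bm[measurable]: "bump m h k \<in> borel_measurable borel" for k
    by (intro borel_measurable_continuous_onI continuous_bump)
  have fhm: "(\<lambda>(x, d). fh x d) \<in> borel_measurable (borel \<Otimes>\<^sub>M data_space n)"
    using fh by (simp add: estimators_def)
  have fh2: "(\<lambda>z. fh (snd z) (fst z)) \<in> borel_measurable (data_space n \<Otimes>\<^sub>M lborel)"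
  proof -
    have "(\<lambda>z. (snd z, fst z)) \<in> measurable (data_space n \<Otimes>\<^sub>M (lborel :: (real^2) measure)) (borel \<Otimes>\<^sub>M data_space n)"
      by measurable
    from measurable_compose[OF this fhm] show ?thesis by simp
  qed
  have fh1: "(\<lambda>x. fh x d) \<in> borel_measurable borel" if "d \<in> space (data_space n)" for d
    using measurable_compose[OF measurable_Pair2'[OF that] fhm] by simp
  have Am: "A S k \<in> borel_measurable (data_space n)" for S k
    unfolding A_def
  proof (rule lborel.borel_measurable_nn_integral)
    note [measurable] = fh2
    have "(\<lambda>z. ennreal (\<bar>fh (snd z) (fst z) - ?f S (snd z)\<bar>\<^sup>2) * indicator (cell h k) (snd z))
        \<in> borel_measurable (data_space n \<Otimes>\<^sub>M lborel)"
      by measurable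
    then show "(\<lambda>(d, x). ennreal (\<bar>fh x d - ?f S x\<bar>\<^sup>2) * indicator (cell h k) x)
        \<in> borel_measurable (data_space n \<Otimes>\<^sub>M lborel)"
      by (simp add: case_prod_unfold)
  qed
  have Z1: "norm (fst z) = 1" if "z \<in> space Z_measure" for z
    using that by (auto simp: space_Z_measure)
  have "of_nat (card ?J) * ennreal (?\<delta> * exp (- (m0 + 1))) \<le> 2 * ?s"
  proof (rule assouad[where R = R])
    fix k S assume k: "k \<in> ?J" and S: "S \<subseteq> ?J - {k}"
    then have iS: "insert k S \<subseteq> ?J" "k \<notin> S" by auto
    have fS: "?f (insert k S) x = ?f S x + a * bump m h k x" for x
      using S finite_subset[of S "?J - {k}"] iS by (simp add: bump_sum_def algebra_simps)
    have dT: "?T (?f S) z - ?T (?f (insert k S)) z = - (a * ?T (bump m h k) z)"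
      if "z \<in> space Z_measure" for z
      using exp_radon_bump_sum_insert[OF mh iS Z1[OF that], of \<mu> a "snd z"] by simp
    show "ennreal (?\<delta> * exp (- (m0 + 1))) \<le> R S k + R (insert k S) k"
      unfolding R_def
    proof (rule data_law_two_point[OF M Xm \<epsilon>m ind err G kl I0 fm fm])
      show "\<bar>?T (?f S) z - ?T (?f (insert k S)) z\<bar> \<le> v0" if z: "z \<in> space Z_measure" for z
      proof -
        have "\<bar>?T (bump m h k) z\<bar> \<le> exp \<bar>\<mu>\<bar> * (4 * h)"
          using exp_radon_bump_bound[OF mh k Z1[OF z], of \<mu> "snd z"] mh
          by (auto simp: indicator_def split: if_splits elim: order_trans)
        then have "a * \<bar>?T (bump m h k) z\<bar> \<le> a * (exp \<bar>\<mu>\<bar> * (4 * h))"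
          using a by (intro mult_left_mono)
        then show ?thesis using av a by (simp add: dT[OF z] abs_mult)
      qed
      have [measurable]: "?T (?f S) \<in> borel_measurable Z_measure" for S
        by (intro exp_radon_measurable fm)
      have [measurable]: "?T (bump m h k) \<in> borel_measurable Z_measure"
        by (intro exp_radon_measurable bm)
      have "(\<integral>\<^sup>+\<omega>. (\<Sum>i<n. ennreal (I0 * (?T (?f S) (X i \<omega>) - ?T (?f (insert k S)) (X i \<omega>))\<^sup>2)) \<partial>M)
        \<le> ennreal C3 * of_nat n * (\<integral>\<^sup>+z. ennreal (I0 * (?T (?f S) z - ?T (?f (insert k S)) z)\<^sup>2) \<partial>Z_measure)"
        by (rule design) measurable
      also have "(\<integral>\<^sup>+z. ennreal (I0 * (?T (?f S) z - ?T (?f (insert k S)) z)\<^sup>2) \<partial>Z_measure)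
        = (\<integral>\<^sup>+z. ennreal (I0 * a\<^sup>2) * ennreal ((?T (bump m h k) z)\<^sup>2) \<partial>Z_measure)"
        using I0 by (intro nn_integral_cong) (simp add: dT power_mult_distrib ennreal_mult'[symmetric] mult.assoc)
      also have "\<dots> = ennreal (I0 * a\<^sup>2) * (\<integral>\<^sup>+z. ennreal ((?T (bump m h k) z)\<^sup>2) \<partial>Z_measure)"
        by (rule nn_integral_cmult) measurable
      also have "\<dots> \<le> ennreal (I0 * a\<^sup>2) * ennreal (128 * pi * exp (2 * \<bar>\<mu>\<bar>) * h ^ 3)"
        by (intro mult_left_mono exp_radon_bump_sq[OF mh k]) simp
      also have "\<dots> = ennreal (I0 * a\<^sup>2 * (128 * pi * exp (2 * \<bar>\<mu>\<bar>) * h ^ 3))"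
        using I0 by (simp add: ennreal_mult')
      \<comment> \<open>\<open>ennreal\<close> sends a negative \<open>C3\<close> to 0, hence
        \<open>max 0 C3\<close>.\<close>
      also have "ennreal C3 * of_nat n * \<dots> \<le> ennreal (max 0 C3) * ennreal (real n) * \<dots>"
        by (simp add: ennreal_of_nat_eq_real_of_nat max_def ennreal_neg)
      also have "\<dots> = ennreal (max 0 C3 * real n * (I0 * a\<^sup>2 * (128 * pi * exp (2 * \<bar>\<mu>\<bar>) * h ^ 3)))"
        by (simp add: ennreal_mult')
      also have "\<dots> \<le> ennreal m0" by (rule ennreal_leI[OF m0(1)])
      finally show "(\<integral>\<^sup>+\<omega>. (\<Sum>i<n. ennreal (I0 * (?T (?f S) (X i \<omega>) - ?T (?f (insert k S)) (X i \<omega>))\<^sup>2)) \<partial>M) \<le> ennreal m0"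
        by (simp add: mult_left_mono)
      show "ennreal ?\<delta> \<le> A S k d + A (insert k S) k d" if d: "d \<in> space (data_space n)" for d
      proof -
        note [measurable] = fh1[OF d]
        have "ennreal ?\<delta> = ennreal (a\<^sup>2 / 2) * (ennreal (h\<^sup>2) * (ennreal J)\<^sup>2)"
          using J(2) by (simp add: ennreal_power ennreal_mult'[symmetric])
        also have "\<dots> = ennreal (a\<^sup>2 / 2) * (\<integral>\<^sup>+x. ennreal ((bump m h k x)\<^sup>2) \<partial>lborel)"
          by (simp only: nn_integral_bump_sq[OF mh(1,2)] J(1))
        also have "\<dots> = (\<integral>\<^sup>+x. ennreal (a\<^sup>2 / 2) * ennreal ((bump m h k x)\<^sup>2) \<partial>lborel)"
          by (rule nn_integral_cmult[symmetric]) measurable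
        \<comment> \<open>The two candidates differ by the bump, which vanishes off the cell, so
          restricting the losses to the cell loses nothing.\<close>
        also have "\<dots> \<le> (\<integral>\<^sup>+x. ennreal (\<bar>fh x d - ?f S x\<bar>\<^sup>2) * indicator (cell h k) x
            + ennreal (\<bar>fh x d - ?f (insert k S) x\<bar>\<^sup>2) * indicator (cell h k) x \<partial>lborel)"
        proof (rule nn_integral_mono)
          fix x
          have par: "(u - w)\<^sup>2 / 2 \<le> \<bar>y - u\<bar>\<^sup>2 + \<bar>y - w\<bar>\<^sup>2" for u w y :: real
          proof -
            have "2 * ((y - u)\<^sup>2 + (y - w)\<^sup>2) = (u - w)\<^sup>2 + ((y - u) + (y - w))\<^sup>2"
              by (simp add: power2_eq_square algebra_simps)
            then have "(u - w)\<^sup>2 \<le> ((y - u)\<^sup>2 + (y - w)\<^sup>2) * 2"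
              by (metis le_add_same_cancel1 mult.commute zero_le_power2)
            then show ?thesis by (simp only: power2_abs divide_le_eq_numeral1)
          qed
          have "a\<^sup>2 / 2 * (bump m h k x)\<^sup>2 \<le> \<bar>fh x d - ?f S x\<bar>\<^sup>2 + \<bar>fh x d - ?f (insert k S) x\<bar>\<^sup>2"
            using par[of "?f S x" "?f (insert k S) x" "fh x d"] by (simp add: fS power_mult_distrib)
          then have "ennreal (a\<^sup>2 / 2 * (bump m h k x)\<^sup>2)
            \<le> ennreal (\<bar>fh x d - ?f S x\<bar>\<^sup>2) + ennreal (\<bar>fh x d - ?f (insert k S) x\<bar>\<^sup>2)"
            using ennreal_leI by (subst ennreal_plus[symmetric]) (simp_all only: zero_le_power2)
          then show "ennreal (a\<^sup>2 / 2) * ennreal ((bump m h k x)\<^sup>2) \<le>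
            ennreal (\<bar>fh x d - ?f S x\<bar>\<^sup>2) * indicator (cell h k) x
            + ennreal (\<bar>fh x d - ?f (insert k S) x\<bar>\<^sup>2) * indicator (cell h k) x"
            using bump_eq_0[OF mh(1,2), of x k]
            by (cases "x \<in> cell h k") (simp_all add: ennreal_mult'[symmetric])
        qed
        also have "\<dots> = A S k d + A (insert k S) k d"
          unfolding A_def by (rule nn_integral_add) measurable
        finally show ?thesis .
      qed
    qed (use m0 Am in auto)
  next
    fix S assume S: "S \<subseteq> ?J"
    have sets: "sets (data_law \<mu> M n X \<epsilon> (?f S)) = sets (data_space n)"
      by (simp add: data_law_def)
    have "(\<Sum>k\<in>?J. R S k) = (\<integral>\<^sup>+d. (\<Sum>k\<in>?J. A S k d) \<partial>data_law \<mu> M n X \<epsilon> (?f S))"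
      unfolding R_def using Am sets measurable_cong_sets by (subst nn_integral_sum) blast+
    also have "\<dots> \<le> MISE (data_law \<mu> M n X \<epsilon> (?f S)) fh (?f S)"
      unfolding MISE_def
    proof (rule nn_integral_mono)
      fix d assume "d \<in> space (data_law \<mu> M n X \<epsilon> (?f S))"
      then have "d \<in> space (data_space n)" by (simp add: data_law_def)
      note [measurable] = fh1[OF this]
      have "(\<Sum>k\<in>?J. A S k d) = (\<integral>\<^sup>+x. (\<Sum>k\<in>?J. ennreal (\<bar>fh x d - ?f S x\<bar>\<^sup>2) * indicator (cell h k) x) \<partial>lborel)"
        unfolding A_def by (subst nn_integral_sum) measurable
      also have "\<dots> \<le> (\<integral>\<^sup>+x. ennreal (\<bar>fh x d - ?f S x\<bar>\<^sup>2) * indicator (cball 0 1) x \<partial>lborel)"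
      proof (rule nn_integral_mono)
        fix x
        have sub: "(\<Union>k\<in>?J. cell h k) \<subseteq> cball 0 1"
          by (intro UN_least cell_subset_cball[OF mh(2,3)])
        have "(\<Sum>k\<in>?J. indicator (cell h k) x) = (indicator (\<Union>k\<in>?J. cell h k) x :: ennreal)"
          by (rule indicator_UN_disjoint[symmetric])
             (auto simp: disjoint_family_on_def dest: cell_disjoint)
        also have "\<dots> \<le> indicator (cball 0 1) x"
          using subsetD[OF sub, of x] unfolding indicator_def by (cases "x \<in> (\<Union>k\<in>?J. cell h k)") (simp_all only: if_True if_False order_refl zero_le of_bool_eq)
        finally show "(\<Sum>k\<in>?J. ennreal (\<bar>fh x d - ?f S x\<bar>\<^sup>2) * indicator (cell h k) x)
          \<le> ennreal (\<bar>fh x d - ?f S x\<bar>\<^sup>2) * indicator (cball 0 1) x"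
          unfolding sum_distrib_left[symmetric] by (rule mult_left_mono) simp
      qed
      finally show "(\<Sum>k\<in>?J. A S k d) \<le> (\<integral>\<^sup>+x. ennreal (\<bar>fh x d - ?f S x\<bar>\<^sup>2) * indicator (cball 0 1) x \<partial>lborel)" .
    qed
    also have "\<dots> \<le> ?s"
      by (rule SUP_upper[OF F[OF S]])
    finally show "(\<Sum>k\<in>?J. R S k) \<le> ?s" .
  qed simp
  \<comment> \<open>The 4 in the conclusion is the 2 of Assouad's lemma times the 2 of the
    parallelogram inequality.\<close>
  moreover have "of_nat (card ?J) * ennreal (?\<delta> * exp (- (m0 + 1)))
      = 2 * ennreal ((real K)\<^sup>2 * (a\<^sup>2 * h\<^sup>2 * J\<^sup>2 * exp (- (m0 + 1))) / 4)"
  proof -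
    have "of_nat (card ?J) = ennreal ((real K)\<^sup>2)"
      by (simp add: ennreal_of_nat_eq_real_of_nat power2_eq_square)
    moreover have "(2::ennreal) = ennreal 2" by simp
    ultimately show ?thesis
      by (simp only: ennreal_mult'[symmetric] zero_le_power2 zero_le_numeral) simp
  qed
  ultimately have "2 * ennreal ((real K)\<^sup>2 * (a\<^sup>2 * h\<^sup>2 * J\<^sup>2 * exp (- (m0 + 1))) / 4) \<le> 2 * ?s"
    by simp
  then show ?thesis
    by (subst (asm) ennreal_mult_le_mult_iff) auto
qed

theorem theorem6:
  fixes \<beta> L \<mu> \<sigma> I0 v0 C3 :: real
    and G :: "real measure"
    and M :: "nat \<Rightarrow> 'w measure"
    and X :: "nat \<Rightarrow> nat \<Rightarrow> 'w \<Rightarrow> (real^2) \<times> real"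
    and \<epsilon> :: "nat \<Rightarrow> nat \<Rightarrow> 'w \<Rightarrow> real"
  assumes "\<beta> > 1" and "L > 0"
    and prob: "\<And>n. prob_space (M n)"
    and design_iid: "\<And>n. iid_vars (M n) Z_measure {..<n} (X n)"
    and errors_iid: "\<And>n. iid_vars (M n) borel {..<n} (\<epsilon> n)"
    and design_indep_errors:
      "\<And>n. indep_rv (M n)
              (PiM {..<n} (\<lambda>_. Z_measure)) (\<lambda>\<omega>. \<lambda>i\<in>{..<n}. X n i \<omega>)
              (PiM {..<n} (\<lambda>_. borel)) (\<lambda>\<omega>. \<lambda>i\<in>{..<n}. \<epsilon> n i \<omega>)"
    and error_law: "real_distribution G"
      "\<And>n i. i < n \<Longrightarrow> distr (M n) borel (\<epsilon> n i) = G"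
    and error_moments: "integrable G (\<lambda>u. u)" "(LINT u|G. u) = 0"
      "integrable G (\<lambda>u. u\<^sup>2)" "(LINT u|G. u\<^sup>2) = \<sigma>\<^sup>2" "\<sigma>\<^sup>2 > 0"
    and B1: "I0 > 0" "v0 > 0"
      "\<And>v. \<bar>v\<bar> \<le> v0 \<Longrightarrow> kullback G (distr G borel (\<lambda>u. u - v)) \<le> ereal (I0 * v\<^sup>2)"
    and B2: "\<And>n (g :: (real^2) \<times> real \<Rightarrow> ennreal). g \<in> borel_measurable Z_measure \<Longrightarrow>
      (\<integral>\<^sup>+ \<omega>. (\<Sum>i<n. g (X n i \<omega>)) \<partial>M n)
        \<le> ennreal C3 * of_nat n * (\<integral>\<^sup>+ z. g z \<partial>Z_measure)"
  shows "\<exists>c1>0. ennreal c1 \<le>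
    liminf (\<lambda>n. INF fh \<in> estimators n. SUP f \<in> sobolev_class \<beta> L.
      ennreal (inverse ((rate \<beta> n)\<^sup>2)) * MISE (data_law \<mu> (M n) n (X n) (\<epsilon> n) f) fh f)"
proof -
  define m where "m = nat \<lceil>\<beta> + 1\<rceil>"
  have m: "m > 0" "real m \<ge> \<beta> + 1" using \<open>\<beta> > 1\<close> unfolding m_def by linarith+
  have \<beta>: "\<beta> \<ge> 0" using \<open>\<beta> > 1\<close> by simp
  obtain c0 where c0: "c0 > 0" and sob: "\<And>h K S c. 0 < h \<Longrightarrow> h \<le> 1 \<Longrightarrow> real K * h \<le> 1 / 2 \<Longrightarrow>
      S \<subseteq> {..<K} \<times> {..<K} \<Longrightarrow> 0 \<le> c \<Longrightarrow> c \<le> c0 \<Longrightarrow>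
      bump_sum m h (c * h powr \<beta>) S \<in> sobolev_class \<beta> L"
    using bump_sum_sobolev[OF m \<beta> \<open>L > 0\<close>] by blast
  obtain J where J: "J > 0" "(\<integral>\<^sup>+t. ennreal ((bump1 m t)\<^sup>2) \<partial>lborel) = ennreal J"
    using nn_integral_bump1_sq[OF m(1)] by blast
  \<comment> \<open>The first bound keeps the functions in the Sobolev class, the second keeps every
    Radon difference within v0.\<close>
  define c where "c = min c0 (v0 / (4 * exp \<bar>\<mu>\<bar>))"
  have c: "c > 0" "c \<le> c0" "c * (4 * exp \<bar>\<mu>\<bar>) \<le> v0"
    using c0 \<open>v0 > 0\<close> unfolding c_def
    by (simp, simp, simp only: pos_le_divide_eq[symmetric] mult_pos_pos zero_less_numeral exp_gt_zero min.cobounded2)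
  \<comment> \<open>The bound for the mean Kullback distance between neighbours, using n h^(2 beta +
    3) <= 1; it is free of n.\<close>
  define m0 where "m0 = max 0 C3 * (I0 * c\<^sup>2 * (128 * pi * exp (2 * \<bar>\<mu>\<bar>)))"
  have m0: "m0 \<ge> 0" using \<open>I0 > 0\<close> unfolding m0_def by (intro mult_nonneg_nonneg) auto
  define E where "E = J\<^sup>2 * exp (- (m0 + 1))"
  have E: "E > 0" using J unfolding E_def by simp
  \<comment> \<open>The power of 4 is the loss from rounding the grid size, h >= 1 / (4 q). The 16
    is the 4 of the risk bound times the 4 from (K h)^2 = 1/4.\<close>
  define c1 where "c1 = c\<^sup>2 * 4 powr (- 2 * \<beta>) * E / 16"
  have "c1 > 0" using c E unfolding c1_def by simp
  moreover have "ennreal c1 \<le> liminf (\<lambda>n. INF fh \<in> estimators n. SUP f \<in> sobolev_class \<beta> L.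
      ennreal (inverse ((rate \<beta> n)\<^sup>2)) * MISE (data_law \<mu> (M n) n (X n) (\<epsilon> n) f) fh f)"
  proof (rule Liminf_bounded, rule eventually_sequentiallyI[of 1], rule INF_greatest)
    \<comment> \<open>The bound holds for every n >= 1; for n = 0 the grid defined below would be
      empty.\<close>
    fix n :: nat and fh assume n: "1 \<le> n" and fh: "fh \<in> estimators n"
    interpret prob_space "M n" by (rule prob)
    \<comment> \<open>The inverse of the ideal width: q^(2 beta + 3) = n.\<close>
    define q where "q = real n powr (1 / (2 * \<beta> + 3))"
    define K where "K = nat \<lceil>q\<rceil>"
    \<comment> \<open>Fixed after rounding K, so that the grid has side exactly 1/2; then h still
      agrees with 1 / q up to constants.\<close>
    define h where "h = 1 / (2 * real K)"
    have q1: "q \<ge> 1" using n \<beta> unfolding q_def by (intro ge_one_powr_ge_zero) auto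
    have K: "q \<le> real K" "real K \<le> 2 * q" using q1 unfolding K_def by linarith+
    have Kpos: "real K > 0" using K q1 by linarith
    have h: "h > 0" "h \<le> 1" "real K * h = 1 / 2"
      using Kpos K q1 unfolding h_def by (auto simp: field_simps)
    have hq: "h \<le> 1 / q" "1 / (4 * q) \<le> h"
      using K q1 Kpos unfolding h_def by (auto intro!: divide_left_mono mult_pos_pos)
    have qn: "q powr (2 * \<beta> + 3) = real n"
      using n \<beta> unfolding q_def by (simp add: powr_powr)
    have "h powr (2 * \<beta> + 3) \<le> (1 / q) powr (2 * \<beta> + 3)"
      using h hq \<beta> by (intro powr_mono2) auto
    also have "\<dots> = 1 / real n" using q1 by (simp add: powr_divide qn)
    finally have hn: "real n * h powr (2 * \<beta> + 3) \<le> 1" using n by (simp add: field_simps)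
    define a where "a = c * h powr \<beta>"
    have a0: "a \<ge> 0" using c unfolding a_def by simp
    have h2\<beta>: "(h powr \<beta>)\<^sup>2 = h powr (2 * \<beta>)" using h by (simp add: powr_power mult.commute)
    have "a\<^sup>2 * h ^ 3 = c\<^sup>2 * h powr (2 * \<beta> + 3)"
      using h by (simp add: a_def power_mult_distrib h2\<beta> powr_add powr_numeral)
    \<comment> \<open>The Kullback budget: n observations, each contributing a^2 h^3 up to
      constants.\<close>
    then have na: "real n * (a\<^sup>2 * h ^ 3) \<le> c\<^sup>2"
      using mult_left_mono[OF hn, of "c\<^sup>2"] by (simp add: ac_simps)
    have lower: "ennreal ((real K)\<^sup>2 * (a\<^sup>2 * h\<^sup>2 * J\<^sup>2 * exp (- (m0 + 1))) / 4)
      \<le> (SUP f\<in>sobolev_class \<beta> L. MISE (data_law \<mu> (M n) n (X n) (\<epsilon> n) f) fh f)"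
    proof (rule bump_sum_risk_lower_bound[where G = G and ?I0.0 = I0 and ?v0.0 = v0 and ?C3.0 = C3 and ?m0.0 = m0 and m = m and K = K and h = h and a = a])
      have iX: "indep_vars (\<lambda>_. Z_measure) (X n) {..<n}" and ie: "indep_vars (\<lambda>_. borel) (\<epsilon> n) {..<n}"
        using design_iid[of n] errors_iid[of n] by (auto simp: iid_vars_def)
      show "X n i \<in> measurable (M n) Z_measure" if "i < n" for i
        using iX that by (auto simp: indep_vars_def2)
      show em: "\<epsilon> n i \<in> borel_measurable (M n)" if "i < n" for i
        using ie that by (auto simp: indep_vars_def2)
      have ne: "{..<n} \<noteq> {}" using n by (simp add: lessThan_empty_iff)
      have "distr (M n) (PiM {..<n} (\<lambda>_. borel)) (\<lambda>\<omega>. \<lambda>i\<in>{..<n}. \<epsilon> n i \<omega>)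
          = PiM {..<n} (\<lambda>i. distr (M n) borel (\<epsilon> n i))"
        using ie em ne by (subst (asm) indep_vars_iff_distr_eq_PiM') auto
      also have "\<dots> = PiM {..<n} (\<lambda>_. G)"
        by (intro PiM_cong) (auto simp: error_law)
      finally show "distr (M n) (PiM {..<n} (\<lambda>_. borel)) (\<lambda>\<omega>. \<lambda>i\<in>{..<n}. \<epsilon> n i \<omega>) = PiM {..<n} (\<lambda>_. G)" .
      have "a * h \<le> c * 1"
      proof -
        have "h powr \<beta> \<le> 1" using h \<beta> by (intro powr_le1) auto
        then have "h powr \<beta> * h \<le> 1" using h by (intro mult_le_one) auto
        then show ?thesis using c unfolding a_def by (simp add: mult.assoc)
      qed
      then have "a * h * (4 * exp \<bar>\<mu>\<bar>) \<le> v0"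
        by (intro order_trans[OF mult_right_mono c(3)]) auto
      then show "a * (exp \<bar>\<mu>\<bar> * (4 * h)) \<le> v0" by (simp add: ac_simps)
      have "max 0 C3 * I0 * (128 * pi * exp (2 * \<bar>\<mu>\<bar>)) * (real n * (a\<^sup>2 * h ^ 3))
        \<le> max 0 C3 * I0 * (128 * pi * exp (2 * \<bar>\<mu>\<bar>)) * c\<^sup>2"
        using \<open>I0 > 0\<close> by (intro mult_left_mono na mult_nonneg_nonneg) auto
      then show "max 0 C3 * real n * (I0 * a\<^sup>2 * (128 * pi * exp (2 * \<bar>\<mu>\<bar>) * h ^ 3)) \<le> m0"
        by (simp only: m0_def ac_simps)
      show "bump_sum m h a S \<in> sobolev_class \<beta> L" if "S \<subseteq> {..<K} \<times> {..<K}" for S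
        unfolding a_def using h c that by (intro sob[where K = K]) auto
    qed (use h m m0 J a0 fh prob design_indep_errors error_law(1) B1 B2 in auto)
    \<comment> \<open>Since K h = 1/2, the K^2 cells cover a fixed area and only the squared height
      h^(2 beta) remains.\<close>
    have K2: "(real K)\<^sup>2 * (a\<^sup>2 * h\<^sup>2 * J\<^sup>2 * exp (- (m0 + 1))) / 4 = c\<^sup>2 * h powr (2 * \<beta>) * E / 16"
    proof -
      have "(real K)\<^sup>2 * (a\<^sup>2 * h\<^sup>2 * J\<^sup>2 * exp (- (m0 + 1))) / 4 = (real K * h)\<^sup>2 * a\<^sup>2 * E / 4"
        by (simp add: E_def power_mult_distrib)
      also have "\<dots> = (1 / 2)\<^sup>2 * (c\<^sup>2 * h powr (2 * \<beta>)) * E / 4"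
        by (simp only: h(3) a_def power_mult_distrib h2\<beta>)
      finally show ?thesis by (simp add: power2_eq_square)
    qed
    \<comment> \<open>\<open>rate \<beta> n\<close> is q^(- beta), so its inverse square cancels
      h^(2 beta) up to the rounding constant.\<close>
    have r2: "inverse ((rate \<beta> n)\<^sup>2) = q powr (2 * \<beta>)"
      using n by (simp add: rate_def q_def powr_powr powr_power powr_minus[symmetric])
    have "4 powr (- 2 * \<beta>) = q powr (2 * \<beta>) * (1 / (4 * q)) powr (2 * \<beta>)"
      using q1 by (simp add: powr_divide powr_mult powr_minus_divide)
    also have "\<dots> \<le> q powr (2 * \<beta>) * h powr (2 * \<beta>)"
      using hq(2) q1 \<beta> by (intro mult_left_mono powr_mono2) auto
    finally have "4 powr (- 2 * \<beta>) * (c\<^sup>2 * E / 16) \<le> q powr (2 * \<beta>) * h powr (2 * \<beta>) * (c\<^sup>2 * E / 16)"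
      using E by (intro mult_right_mono) auto
    then have "c1 \<le> inverse ((rate \<beta> n)\<^sup>2) * (c\<^sup>2 * h powr (2 * \<beta>) * E / 16)"
      unfolding r2 c1_def by (simp add: ac_simps)
    then have "ennreal c1 \<le> ennreal (inverse ((rate \<beta> n)\<^sup>2)) * ennreal (c\<^sup>2 * h powr (2 * \<beta>) * E / 16)"
      by (simp add: ennreal_mult'[symmetric] ennreal_leI)
    also have "\<dots> \<le> ennreal (inverse ((rate \<beta> n)\<^sup>2)) *
        (SUP f\<in>sobolev_class \<beta> L. MISE (data_law \<mu> (M n) n (X n) (\<epsilon> n) f) fh f)"
      using lower unfolding K2 by (intro mult_left_mono) auto
    also have "\<dots> = (SUP f\<in>sobolev_class \<beta> L. ennreal (inverse ((rate \<beta> n)\<^sup>2)) *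
        MISE (data_law \<mu> (M n) n (X n) (\<epsilon> n) f) fh f)"
      by (rule SUP_mult_left_ennreal)
    finally show "ennreal c1 \<le> (SUP f\<in>sobolev_class \<beta> L. ennreal (inverse ((rate \<beta> n)\<^sup>2)) *
        MISE (data_law \<mu> (M n) n (X n) (\<epsilon> n) f) fh f)" .
  qed
  ultimately show ?thesis by blast
qed

end
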